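(* Let $k\ge 2$ be a fixed integer and let $\alpha,\beta>0$ be fixed constants. For even $n$ let $p=\frac{\alpha\log n}{\binom{n-1}{k-1}}$ and $q=\frac{\beta\log n}{\binom{n-1}{k-1}}$, and set $$I(\alpha,\beta)=\frac{1}{2^{k-1}}\left(\sqrt{\alpha}-\sqrt{\beta}\right)^2.$$ Then exact recovery in $\mathsf{HSBM}(n,p,q;k)$ is possible if $I(\alpha,\beta)>1$, and impossible if $I(\alpha,\beta)<1$.
   Context: Model: let $n$ be an even positive integer, $V=\{1,\dots,n\}$, $\binom{V}{k}$ the collection of $k$-element subsets of $V$, and $p,q\in[0,1]$. The model $\mathsf{HSBM}(n,p,q;k)$ samples a pair $(\sigma,\mathcal{H})$ as follows. First $\sigma\in\{\pm1\}^V$ is chosen uniformly at random among vectors with equally many $+1$'s and $-1$'s. Then, given $\sigma$, $\mathcal{H}$ is a random $k$-uniform hypergraph on $V$ in which each $e=\{e_1,\dots,e_k\}\in\binom{V}{k}$ is a hyperedge independently, with probability $p$ if $\sigma_{e_1}=\cdots=\sigma_{e_k}$ and with probability $q$ otherwise. An estimator is a map $\widehat\sigma$ assigning to each $k$-uniform hypergraph on $V$ a vector in $\{\pm1\}^V$ (one map for each $n$). Exact recovery is possible if there exists an estimator $\widehat\sigma$ with $\mathbb{P}_{(\sigma,\mathcal{H})}\left(\widehat\sigma(\mathcal{H})\notin\{\sigma,-\sigma\}\right)=o(1)$ as $n\to\infty$. Exact recovery is impossible if for every estimator $\widehat\sigma$, $\mathbb{P}_{(\sigma,\mathcal{H})}\left(\widehat\sigma(\mathcal{H})\notin\{\sigma,-\sigma\}\right)=1-o(1)$.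 All asymptotics are as $n\to\infty$ along even integers, with $k,\alpha,\beta$ fixed (the edge probabilities are considered for $n$ large enough that they lie in $[0,1]$). *)

theory Defs
  imports "HOL-Probability.Probability" "HOL-Library.Ramsey"
begin

text \<open>
  Vectors in \<open>{+1,-1}\<^sup>V\<close> with \<open>V = {1..n}\<close> are functions that vanish off \<open>V\<close>, so that each vector
  has exactly one representative and pointwise negation maps representatives to representatives.
\<close>

definition sign_vectors :: "nat \<Rightarrow> (nat \<Rightarrow> int) set" where
  "sign_vectors n = PiE_dflt {1..n} 0 (\<lambda>_. {1, -1})"

definition balanced_sign_vectors :: "nat \<Rightarrow> (nat \<Rightarrow> int) set" where
  "balanced_sign_vectors n =
     {\<sigma> \<in> sign_vectors n. card {v \<in> {1..n}. \<sigma> v = 1} = card {v \<in> {1..n}. \<sigma> v = -1}}"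

text \<open>
  A \<open>k\<close>-uniform hypergraph on \<open>{1..n}\<close> is identified with its edge set, a subset of
  \<open>nsets {1..n} k\<close>. The library clamps the parameter of \<^const>\<open>bernoulli_pmf\<close> to the unit
  interval, so the definition is the intended one exactly when \<open>p\<close> and \<open>q\<close> lie in \<open>[0,1]\<close>.
\<close>

definition random_hypergraph ::
    "nat \<Rightarrow> real \<Rightarrow> real \<Rightarrow> nat \<Rightarrow> (nat \<Rightarrow> int) \<Rightarrow> nat set set pmf" where
  "random_hypergraph n p q k \<sigma> =
     map_pmf (\<lambda>X. {e \<in> nsets {1..n} k. X e})
       (Pi_pmf (nsets {1..n} k) False
         (\<lambda>e. bernoulli_pmf (if \<forall>u\<in>e. \<forall>v\<in>e. \<sigma> u = \<sigma> v then p else q)))"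

text \<open>Only meaningful for even \<open>n\<close>: otherwise there are no balanced vectors.\<close>

definition HSBM ::
    "nat \<Rightarrow> real \<Rightarrow> real \<Rightarrow> nat \<Rightarrow> ((nat \<Rightarrow> int) \<times> nat set set) pmf" where
  "HSBM n p q k =
     bind_pmf (pmf_of_set (balanced_sign_vectors n))
       (\<lambda>\<sigma>. map_pmf (\<lambda>H. (\<sigma>, H)) (random_hypergraph n p q k \<sigma>))"

definition is_estimator :: "nat \<Rightarrow> (nat \<Rightarrow> nat set set \<Rightarrow> nat \<Rightarrow> int) \<Rightarrow> bool" where
  "is_estimator k est \<longleftrightarrow> (\<forall>n. \<forall>H \<subseteq> nsets {1..n} k. est n H \<in> sign_vectors n)"

definition error_prob ::
    "nat \<Rightarrow> real \<Rightarrow> real \<Rightarrow> nat \<Rightarrow> (nat set set \<Rightarrow> nat \<Rightarrow> int) \<Rightarrow> real" where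
  "error_prob n p q k est =
     measure_pmf.prob (HSBM n p q k) {(\<sigma>, H). est H \<notin> {\<sigma>, (\<lambda>v. - \<sigma> v)}}"

definition even_sequentially :: "nat filter" where
  "even_sequentially = inf sequentially (principal {n. even n})"

definition exact_recovery_possible :: "nat \<Rightarrow> (nat \<Rightarrow> real) \<Rightarrow> (nat \<Rightarrow> real) \<Rightarrow> bool" where
  "exact_recovery_possible k p q \<longleftrightarrow>
     (\<exists>est. is_estimator k est \<and>
        ((\<lambda>n. error_prob n (p n) (q n) k (est n)) \<longlongrightarrow> 0) even_sequentially)"

definition exact_recovery_impossible :: "nat \<Rightarrow> (nat \<Rightarrow> real) \<Rightarrow> (nat \<Rightarrow> real) \<Rightarrow> bool" where
  "exact_recovery_impossible k p q \<longleftrightarrow>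
     (\<forall>est. is_estimator k est \<longrightarrow>
        ((\<lambda>n. error_prob n (p n) (q n) k (est n)) \<longlongrightarrow> 1) even_sequentially)"

definition recovery_threshold :: "nat \<Rightarrow> real \<Rightarrow> real \<Rightarrow> real" where
  "recovery_threshold k \<alpha> \<beta> = 1 / 2 ^ (k - 1) * (sqrt \<alpha> - sqrt \<beta>)\<^sup>2"

end

(*
  Possible: the maximum likelihood estimator errs only if some balanced vector tau, which differs
  from sigma by t swaps between the communities, is at least as likely as sigma. This costs
  exp (- D * (sqrt p - sqrt q)^2 / 2), where D is the number of edges whose status differs. Already
  the edges with exactly one swapped vertex give D >= 4 * t * C(n/2 - t, k - 1), which defeats the
  at most C(n/2, t)^2 vectors at distance t, uniformly in t <= n/4. The case t > n/4 reduces to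
  this one by negating tau.

  Impossible: call a vertex tied if it lies in as many edges that are uniform now as in edges
  that would be uniform after flipping it. Exchanging a tied vertex of each community does not
  change the likelihood, up to edges shared with other selected vertices. In random sets of
  n^(1 - eps) vertices of each community such shared edges are rare, the ties are independent, and
  each has probability at least n^(-gamma) with gamma + eps < 1. By the second moment
  method there are many ties, so many balanced vectors are exactly as likely as sigma, and
  no estimator can tell them apart.
*)
theory Submission
  imports Defs "HOL-Real_Asymp.Real_Asymp"
begin

subsection \<open>Random subsets\<close>

text \<open>Both halves meet at the same exponent. As C(n/2, k-1) / C(n-1, k-1) tends to 2^-(k-1),
  the roughly 4 t C(n/2, k-1) changed edges cost n^(-2 t I) against about n^(2 t) competitors, which
  asks for I > 1. A tie is a collision of two independent binomial variables with N about C(n/2,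
  k-1) trials. Its probability is, up to a logarithmic factor, at least the Bhattacharyya
  coefficient to the power 2 N, that is about n^(-I), and fewer than n vertices compete, which asks
  for I < 1. So asking for exact equality instead of a strict gain loses nothing in the exponent,
  and it never matters which of \<alpha> and \<beta> is larger. The obstacle in the second half is
  that the error has to tend to 1, not merely stay away from 0. One competitor is too few: the
  number of ties must tend to infinity, so pairs of ties have to be controlled. Counting only edges
  with a single selected vertex makes different ties exactly independent. The selected sets are
  fixed before the hypergraph is drawn; all randomness lies in the edges.\<close>

definition random_subset :: "'a set \<Rightarrow> ('a \<Rightarrow> real) \<Rightarrow> 'a set pmf" where
  "random_subset E r = map_pmf (\<lambda>X. {e\<in>E. X e}) (Pi_pmf E False (\<lambda>e. bernoulli_pmf (r e)))"

lemma set_pmf_random_subset: "set_pmf (random_subset E r) \<subseteq> Pow E"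
  by (auto simp: random_subset_def)

lemma pmf_random_subset:
  assumes "finite E" "H \<subseteq> E" "\<And>e. e \<in> E \<Longrightarrow> r e \<in> {0..1}"
  shows "pmf (random_subset E r) H = (\<Prod>e\<in>E. if e \<in> H then r e else 1 - r e)"
proof -
  let ?S = "{X. \<forall>e. e \<notin> E \<longrightarrow> X e = False}"
  let ?P = "Pi_pmf E False (\<lambda>e. bernoulli_pmf (r e))"
  have "set_pmf ?P \<subseteq> ?S"
    using set_Pi_pmf_subset[OF assms(1)] by fastforce
  \<comment> \<open>Functions in the support are \<open>False\<close> off \<open>E\<close>, so there
    the set \<open>H\<close> determines \<open>X\<close> completely.\<close>
  then have "(\<lambda>X. {e\<in>E. X e}) -` {H} \<inter> set_pmf ?P = {\<lambda>e. e \<in> H} \<inter> set_pmf ?P"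
    using assms(2) by (auto simp: fun_eq_iff set_eq_iff)
  then have "measure_pmf.prob ?P ((\<lambda>X. {e\<in>E. X e}) -` {H}) = measure_pmf.prob ?P {\<lambda>e. e \<in> H}"
    by (metis measure_Int_set_pmf)
  then have "pmf (random_subset E r) H = pmf ?P (\<lambda>e. e \<in> H)"
    unfolding random_subset_def by (simp add: pmf_map measure_pmf_single)
  also have "\<dots> = (\<Prod>e\<in>E. pmf (bernoulli_pmf (r e)) (e \<in> H))"
    using assms by (intro pmf_Pi') auto
  also have "\<dots> = (\<Prod>e\<in>E. if e \<in> H then r e else 1 - r e)"
    using assms(3) by (intro prod.cong) auto
  finally show ?thesis .
qed

lemma random_subset_Int:
  assumes "finite E" "A \<subseteq> E"
  shows "map_pmf (\<lambda>H. H \<inter> A) (random_subset E r) = random_subset A r"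
proof -
  have "random_subset A r = map_pmf (\<lambda>X. {e\<in>A. X e})
      (map_pmf (\<lambda>f x. if x \<in> A then f x else False) (Pi_pmf E False (\<lambda>e. bernoulli_pmf (r e))))"
    unfolding random_subset_def by (subst Pi_pmf_subset[OF assms]) simp
  also have "\<dots> = map_pmf (\<lambda>H. H \<inter> A) (random_subset E r)"
    unfolding random_subset_def map_pmf_comp using assms(2)
    by (intro map_pmf_cong refl) auto
  finally show ?thesis ..
qed

lemma random_subset_Un:
  assumes "finite A" "finite B" "A \<inter> B = {}"
  shows "random_subset (A \<union> B) r =
    map_pmf (\<lambda>(X, Y). X \<union> Y) (pair_pmf (random_subset A r) (random_subset B r))"
  unfolding random_subset_def Pi_pmf_union[OF assms] map_pair[symmetric] map_pmf_comp
  using assms(3) by (intro map_pmf_cong refl) auto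

lemma random_subset_Int_pair:
  assumes "finite E" "A \<subseteq> E" "B \<subseteq> E" "A \<inter> B = {}"
  shows "map_pmf (\<lambda>H. (H \<inter> A, H \<inter> B)) (random_subset E r) =
    pair_pmf (random_subset A r) (random_subset B r)"
proof -
  have fin: "finite A" "finite B" using assms(1-3) by (auto intro: finite_subset)
  have "map_pmf (\<lambda>H. (H \<inter> A, H \<inter> B)) (random_subset E r)
      = map_pmf (\<lambda>H. (H \<inter> A, H \<inter> B)) (map_pmf (\<lambda>H. H \<inter> (A \<union> B)) (random_subset E r))"
    unfolding map_pmf_comp by (intro map_pmf_cong refl) auto
  also have "\<dots> = map_pmf (\<lambda>(X, Y). ((X \<union> Y) \<inter> A, (X \<union> Y) \<inter> B))
      (pair_pmf (random_subset A r) (random_subset B r))"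
    using assms by (simp add: random_subset_Int random_subset_Un[OF fin] map_pmf_comp case_prod_unfold)
  also have "\<dots> = map_pmf (\<lambda>z. z) (pair_pmf (random_subset A r) (random_subset B r))"
    using set_pmf_random_subset[of A r] set_pmf_random_subset[of B r] assms(4)
    by (intro map_pmf_cong refl) (auto; blast)
  finally show ?thesis by (simp add: map_pmf_ident)
qed

text \<open>Independence of events that read disjoint sets of edges. Dependence on \<open>A\<close>
  alone is expressed as invariance under intersection with \<open>A\<close>, the form in which
  \<open>tied_restrict\<close> supplies it.\<close>

lemma prob_random_subset_indep:
  assumes "finite E" "A \<subseteq> E" "B \<subseteq> E" "A \<inter> B = {}"
    and "\<And>H. H \<subseteq> E \<Longrightarrow> P H \<longleftrightarrow> P (H \<inter> A)" "\<And>H. H \<subseteq> E \<Longrightarrow> Q H \<longleftrightarrow> Q (H \<inter> B)"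
  shows "measure_pmf.prob (random_subset E r) {H. P H \<and> Q H} =
    measure_pmf.prob (random_subset E r) {H. P H} * measure_pmf.prob (random_subset E r) {H. Q H}"
proof -
  have fin: "finite A" "finite B" using assms(1-3) by (auto intro: finite_subset)
  let ?R = "random_subset E r"
  let ?RA = "random_subset A r" and ?RB = "random_subset B r"
  have s: "set_pmf ?R \<subseteq> Pow E" by (rule set_pmf_random_subset)
  have "measure_pmf.prob ?R {H. P H \<and> Q H} = measure_pmf.prob ?R ((\<lambda>H. (H \<inter> A, H \<inter> B)) -` ({X. P X} \<times> {Y. Q Y}))"
    using s assms(5,6) by (intro measure_eq_AE) (auto simp: AE_measure_pmf_iff)
  also have "\<dots> = measure_pmf.prob (map_pmf (\<lambda>H. (H \<inter> A, H \<inter> B)) ?R) ({X. P X} \<times> {Y. Q Y})"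
    by simp
  also have "\<dots> = measure_pmf.prob (pair_pmf ?RA ?RB) ({X. P X} \<times> {Y. Q Y})"
    by (simp only: random_subset_Int_pair[OF assms(1-4)])
  also have "\<dots> = measure_pmf.prob ?RA {X. P X} * measure_pmf.prob ?RB {Y. Q Y}"
  proof -
    \<comment> \<open>\<open>measure_pmf_prob_product\<close> wants countable events, so both are
      first cut down to finite families of subsets.\<close>
    have "measure_pmf.prob (pair_pmf ?RA ?RB) ({X. P X} \<times> {Y. Q Y}) =
      measure_pmf.prob (pair_pmf ?RA ?RB) ({X\<in>Pow A. P X} \<times> {Y\<in>Pow B. Q Y})"
      using set_pmf_random_subset[of A r] set_pmf_random_subset[of B r]
      by (intro measure_eq_AE) (auto simp: AE_measure_pmf_iff)
    also have "\<dots> = measure_pmf.prob ?RA {X\<in>Pow A. P X} * measure_pmf.prob ?RB {Y\<in>Pow B. Q Y}"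
      by (intro measure_pmf_prob_product countable_finite) (auto simp: fin)
    also have "measure_pmf.prob ?RA {X\<in>Pow A. P X} = measure_pmf.prob ?RA {X. P X}"
      using set_pmf_random_subset[of A r] by (intro measure_eq_AE) (auto simp: AE_measure_pmf_iff)
    also have "measure_pmf.prob ?RB {X\<in>Pow B. Q X} = measure_pmf.prob ?RB {X. Q X}"
      using set_pmf_random_subset[of B r] by (intro measure_eq_AE) (auto simp: AE_measure_pmf_iff)
    finally show ?thesis .
  qed
  also have "measure_pmf.prob ?RA {X. P X} = measure_pmf.prob ?R {H. P H}"
    unfolding random_subset_Int[OF assms(1,2), symmetric] measure_map_pmf
    using s assms(5) by (intro measure_eq_AE) (auto simp: AE_measure_pmf_iff)
  also have "measure_pmf.prob ?RB {X. Q X} = measure_pmf.prob ?R {H. Q H}"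
    unfolding random_subset_Int[OF assms(1,3), symmetric] measure_map_pmf
    using s assms(6) by (intro measure_eq_AE) (auto simp: AE_measure_pmf_iff)
  finally show ?thesis .
qed

lemma prob_random_subset_member:
  assumes "finite E" "e \<in> E" "r e \<in> {0..1}"
  shows "measure_pmf.prob (random_subset E r) {H. e \<in> H} = r e"
proof -
  have "measure_pmf.prob (random_subset E r) {H. e \<in> H}
      = measure_pmf.prob (map_pmf (\<lambda>f. f e) (Pi_pmf E False (\<lambda>e. bernoulli_pmf (r e)))) {True}"
    unfolding random_subset_def measure_map_pmf using assms(2)
    by (intro arg_cong[where f = "measure _"]) auto
  then show ?thesis using assms by (simp add: Pi_pmf_component measure_pmf_single)
qed

lemma prob_random_subset_hits:
  assumes "finite E" "A \<subseteq> E" "\<And>e. e \<in> A \<Longrightarrow> r e \<in> {0..1}" "\<And>e. e \<in> A \<Longrightarrow> r e \<le> b"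
  shows "measure_pmf.prob (random_subset E r) {H. H \<inter> A \<noteq> {}} \<le> real (card A) * b"
proof -
  have "finite A" using assms finite_subset by auto
  have "measure_pmf.prob (random_subset E r) {H. H \<inter> A \<noteq> {}}
      = measure_pmf.prob (random_subset E r) (\<Union>e\<in>A. {H. e \<in> H})"
    by (intro arg_cong[where f = "measure _"]) auto
  also have "\<dots> \<le> (\<Sum>e\<in>A. measure_pmf.prob (random_subset E r) {H. e \<in> H})"
    using \<open>finite A\<close> by (intro measure_pmf.finite_measure_subadditive_finite) auto
  also have "\<dots> \<le> (\<Sum>e\<in>A. b)"
    using assms by (intro sum_mono) (auto simp: prob_random_subset_member subsetD)
  finally show ?thesis by simp
qed

lemma random_subset_card:
  assumes "finite A" "s \<in> {0..1}" "\<And>e. e \<in> A \<Longrightarrow> r e = s"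
  shows "map_pmf card (random_subset A r) = binomial_pmf (card A) s"
proof -
  have "random_subset A r = map_pmf (\<lambda>X. {e\<in>A. X e}) (Pi_pmf A False (\<lambda>e. bernoulli_pmf s))"
    unfolding random_subset_def using assms(3) by (intro arg_cong[where f = "map_pmf _"] Pi_pmf_cong) auto
  then show ?thesis
    by (simp add: map_pmf_comp binomial_pmf_altdef'[OF assms(1) refl assms(2), where dflt = False])
qed

text \<open>With \<open>A\<close> and \<open>B\<close> the private edges of a vertex before and
  after flipping it, this is the probability of a tie: two independent binomial counts
  collide.\<close>

lemma prob_random_subset_card_eq:
  assumes "finite E" "A \<subseteq> E" "B \<subseteq> E" "A \<inter> B = {}" "card A = N" "card B = N"
    and "p \<in> {0..1}" "q \<in> {0..1}" "\<And>e. e \<in> A \<Longrightarrow> r e = p" "\<And>e. e \<in> B \<Longrightarrow> r e = q"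
  shows "measure_pmf.prob (random_subset E r) {H. card (H \<inter> A) = card (H \<inter> B)} =
    (\<Sum>j\<le>N. pmf (binomial_pmf N p) j * pmf (binomial_pmf N q) j)"
proof -
  have fin: "finite A" "finite B" using assms(1-3) by (auto intro: finite_subset)
  have *: "map_pmf (\<lambda>H. (card (H \<inter> A), card (H \<inter> B))) (random_subset E r) =
     pair_pmf (binomial_pmf N p) (binomial_pmf N q)"
  proof -
    have "map_pmf (\<lambda>H. (card (H \<inter> A), card (H \<inter> B))) (random_subset E r) =
      map_pmf (\<lambda>(X, Y). (card X, card Y)) (map_pmf (\<lambda>H. (H \<inter> A, H \<inter> B)) (random_subset E r))"
      by (simp add: map_pmf_comp)
    then show ?thesis
      unfolding random_subset_Int_pair[OF assms(1-4)] map_pair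
      using random_subset_card[OF fin(1) assms(7,9)] random_subset_card[OF fin(2) assms(8,10)] assms(5,6)
      by simp
  qed
  have "measure_pmf.prob (random_subset E r) {H. card (H \<inter> A) = card (H \<inter> B)}
     = measure_pmf.prob (map_pmf (\<lambda>H. (card (H \<inter> A), card (H \<inter> B))) (random_subset E r)) {(i, j). i = j}"
    by (simp add: vimage_def)
  also have "\<dots> = measure_pmf.prob (pair_pmf (binomial_pmf N p) (binomial_pmf N q)) ((\<lambda>j. (j, j)) ` {..N})"
    unfolding * using assms(7,8) set_pmf_binomial_eq[of p N]
    by (intro measure_eq_AE) (auto simp: AE_measure_pmf_iff split: if_splits)
  also have "\<dots> = (\<Sum>j\<le>N. pmf (binomial_pmf N p) j * pmf (binomial_pmf N q) j)"
    by (subst measure_measure_pmf_finite) (auto simp: sum.reindex inj_on_def pmf_pair)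
  finally show ?thesis .
qed

lemma sqrt_prod: "sqrt (\<Prod>x\<in>A. f x) = (\<Prod>x\<in>A. sqrt (f x))"
  by (induction A rule: infinite_finite_induct) (auto simp: real_sqrt_mult)

text \<open>A likelihood comparison costs at most the Bhattacharyya coefficient, since
  \<open>1 \<le> sqrt (L' / L)\<close> on the event \<open>L' \<ge> L\<close>.\<close>

lemma prob_random_subset_likelihood_le:
  assumes "finite E" "\<And>e. e \<in> E \<Longrightarrow> r e \<in> {0..1}" "\<And>e. e \<in> E \<Longrightarrow> r' e \<in> {0..1}"
  shows "measure_pmf.prob (random_subset E r)
      {H. pmf (random_subset E r) H \<le> pmf (random_subset E r') H} \<le>
    (\<Prod>e\<in>E. sqrt (r e * r' e) + sqrt ((1 - r e) * (1 - r' e)))"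
proof -
  let ?L = "pmf (random_subset E r)" and ?L' = "pmf (random_subset E r')"
  have "measure_pmf.prob (random_subset E r) {H. ?L H \<le> ?L' H}
     = measure_pmf.prob (random_subset E r) {H\<in>Pow E. ?L H \<le> ?L' H}"
    using set_pmf_random_subset[of E r] by (intro measure_eq_AE) (auto simp: AE_measure_pmf_iff)
  also have "\<dots> = (\<Sum>H\<in>{H\<in>Pow E. ?L H \<le> ?L' H}. ?L H)"
    using assms(1) by (intro measure_measure_pmf_finite) auto
  also have "\<dots> \<le> (\<Sum>H\<in>{H\<in>Pow E. ?L H \<le> ?L' H}. sqrt (?L H * ?L' H))"
    by (intro sum_mono real_le_rsqrt) (auto simp: power2_eq_square intro!: mult_left_mono)
  \<comment> \<open>Forgetting the event only adds nonnegative terms, and over all of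
    \<open>Pow E\<close> the sum factors edge by edge.\<close>
  also have "\<dots> \<le> (\<Sum>H\<in>Pow E. sqrt (?L H * ?L' H))"
    using assms(1) by (intro sum_mono2) auto
  also have "\<dots> = (\<Sum>H\<in>Pow E. (\<Prod>e\<in>H. sqrt (r e * r' e)) * (\<Prod>e\<in>E - H. sqrt ((1 - r e) * (1 - r' e))))"
  proof (intro sum.cong refl)
    fix H assume H: "H \<in> Pow E"
    then have "finite H" using assms(1) finite_subset by auto
    have "?L H * ?L' H = (\<Prod>e\<in>E. if e \<in> H then r e * r' e else (1 - r e) * (1 - r' e))"
      using H assms by (subst (1 2) pmf_random_subset) (auto simp: prod.distrib[symmetric] intro!: prod.cong)
    also have "\<dots> = (\<Prod>e\<in>H. r e * r' e) * (\<Prod>e\<in>E - H. (1 - r e) * (1 - r' e))"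
      using H assms(1) \<open>finite H\<close> by (subst prod.If_cases) (auto simp: Int_absorb1 Diff_eq)
    finally show "sqrt (?L H * ?L' H) = (\<Prod>e\<in>H. sqrt (r e * r' e)) * (\<Prod>e\<in>E - H. sqrt ((1 - r e) * (1 - r' e)))"
      by (simp add: real_sqrt_mult sqrt_prod)
  qed
  also have "\<dots> = (\<Prod>e\<in>E. sqrt (r e * r' e) + sqrt ((1 - r e) * (1 - r' e)))"
    using assms(1) by (rule prod_add[symmetric])
  finally show ?thesis .
qed

subsection \<open>Bhattacharyya coefficients\<close>

text \<open>The arithmetic mean of \<open>1 - p\<close> and \<open>1 - q\<close> replaces their
  geometric mean; the remaining terms complete the square.\<close>

lemma bhattacharyya_le:
  assumes "(p::real) \<in> {0..1}" "q \<in> {0..1}"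
  shows "sqrt (p * q) + sqrt ((1 - p) * (1 - q)) \<le> 1 - (sqrt p - sqrt q)\<^sup>2 / 2"
proof -
  have "sqrt ((1 - p) * (1 - q)) \<le> ((1 - p) + (1 - q)) / 2"
    using assms by (intro arith_geo_mean_sqrt) auto
  moreover have "(sqrt p - sqrt q)\<^sup>2 = p + q - 2 * sqrt (p * q)"
    using assms by (simp add: power2_diff real_sqrt_mult)
  ultimately show ?thesis by (simp add: field_simps)
qed

text \<open>Converse of \<open>bhattacharyya_le\<close>: replacing the geometric by the arithmetic
  mean loses at most \<open>(p - q)^2 / 2\<close>, which is the main term times
  \<open>(sqrt p + sqrt q)^2\<close> and hence of lower order for small rates.\<close>

lemma bhattacharyya_ge:
  assumes "(p::real) \<in> {0..1/2}" "q \<in> {0..1/2}"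
  shows "sqrt (p * q) + sqrt ((1 - p) * (1 - q)) \<ge>
    1 - (sqrt p - sqrt q)\<^sup>2 / 2 * (1 + (sqrt p + sqrt q)\<^sup>2)"
proof -
  define z d where "z = 1 - (p + q) / 2" and "d = (p - q)\<^sup>2 / 4"
  have z: "z \<ge> 1/2" using assms by (auto simp: z_def)
  have eq: "(1 - p) * (1 - q) = z\<^sup>2 - d" by (simp add: z_def d_def power2_eq_square field_simps)
  have "z\<^sup>2 - d \<ge> 0" unfolding eq[symmetric] using assms by auto
  have "d \<ge> 0" by (simp add: d_def)
  \<comment> \<open>After expansion this reads \<open>4 * d * d + d \<le> 4 * z * d\<close>, for
    which \<open>z \<ge> 1/2\<close> and \<open>d \<le> 1/16\<close> leave room.\<close>
  have "(z - 2 * d)\<^sup>2 \<le> z\<^sup>2 - d"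
  proof -
    have "d * 1 \<le> d * (2 * z)" using z \<open>d \<ge> 0\<close> by (intro mult_left_mono) auto
    moreover have "\<bar>p - q\<bar> \<le> 1/2" using assms by (auto simp: abs_if)
    then have "(p - q)\<^sup>2 \<le> (1/2)\<^sup>2" by (metis abs_le_square_iff abs_of_nonneg zero_le_divide_1_iff zero_le_numeral)
    then have "d \<le> 1/16" by (simp add: d_def power2_eq_square)
    then have "d * d \<le> d * (1/16)" using \<open>d \<ge> 0\<close> by (intro mult_left_mono) auto
    ultimately have "4 * d * d + d \<le> 4 * z * d" 
      using \<open>d \<ge> 0\<close> by (simp add: algebra_simps)
    then show ?thesis by (simp add: power2_eq_square algebra_simps)
  qed
  then have "z - 2 * d \<le> sqrt ((1 - p) * (1 - q))"
    unfolding eq by (rule real_le_rsqrt)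
  moreover have "(sqrt p - sqrt q)\<^sup>2 = p + q - 2 * sqrt (p * q)"
    using assms by (simp add: power2_diff real_sqrt_mult)
  moreover have "(sqrt p - sqrt q)\<^sup>2 * (sqrt p + sqrt q)\<^sup>2 = (p - q)\<^sup>2"
    using assms by (simp add: power_mult_distrib[symmetric] algebra_simps flip: real_sqrt_mult)
  ultimately show ?thesis by (simp add: field_simps z_def d_def)
qed

text \<open>The complete Bhattacharyya sum of two binomial distributions is \<open>(x + y) ^ N\<close>. Cutting it at
  \<open>J\<close> keeps half of it, and Cauchy-Schwarz then turns it into a lower bound for the collision
  probability.\<close>

lemma binomial_collision_ge:
  fixes p q x y :: real and N :: nat
  assumes p: "p \<in> {0..1/2}" and q: "q \<in> {0..1/2}"
  defines "x \<equiv> sqrt (p * q)" and "y \<equiv> sqrt ((1 - p) * (1 - q))"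
  shows "(x + y) ^ (2 * N) / (4 * (4 * N * x + 3)) \<le>
    (\<Sum>j\<le>N. pmf (binomial_pmf N p) j * pmf (binomial_pmf N q) j)"
proof -
  let ?f = "\<lambda>j. pmf (binomial_pmf N p) j * pmf (binomial_pmf N q) j"
  \<comment> \<open>Tilting by \<open>exp j\<close> below multiplies the whole sum by at most
    \<open>exp (4 * N * x)\<close>. A cutoff larger by 1 therefore leaves a tail of at most
    \<open>exp (- 1)\<close>, less than half. Only about \<open>N * x\<close> terms survive, which
    is of order log n in the application, so Cauchy-Schwarz loses just a logarithmic factor.\<close>
  define t where "t = 4 * N * x + 1"
  define J where "J = {j. j \<le> N \<and> real j \<le> t}"
  define S where "S = (x + y) ^ N"
  have [simp]: "finite J" by (auto simp: J_def)
  have x0: "x \<ge> 0" using p q by (auto simp: x_def)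
  have y0: "y \<ge> 1/2"
  proof -
    have "(1/2) * (1/2) \<le> (1 - p) * (1 - q)" using p q by (intro mult_mono) auto
    then show ?thesis unfolding y_def by (intro real_le_rsqrt) (auto simp: power2_eq_square)
  qed
  have S0: "S > 0" using x0 y0 by (auto simp: S_def)
  have f: "sqrt (?f j) = (N choose j) * x ^ j * y ^ (N - j)" for j
  proof -
    have "?f j = (N choose j)\<^sup>2 * (p * q) ^ j * ((1 - p) * (1 - q)) ^ (N - j)"
      using p q by (simp add: power_mult_distrib power2_eq_square)
    then show ?thesis
      using p q by (simp add: real_sqrt_mult real_sqrt_power x_def y_def)
  qed
  have tot: "(\<Sum>j\<le>N. sqrt (?f j)) = S"
    unfolding f S_def by (rule binomial_ring[symmetric])
  \<comment> \<open>Exponential Markov bound: the weight \<open>exp (j - t)\<close> is at least 1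
    beyond the cutoff, and the weighted sum is again a binomial expansion.\<close>
  have "(\<Sum>j\<in>{..N} - J. sqrt (?f j)) \<le> (\<Sum>j\<in>{..N} - J. exp (real j - t) * sqrt (?f j))"
  proof (intro sum_mono)
    fix j assume "j \<in> {..N} - J"
    then have "exp (real j - t) \<ge> 1" by (auto simp: J_def)
    then have "1 * sqrt (?f j) \<le> exp (real j - t) * sqrt (?f j)"
      by (intro mult_right_mono) auto
    then show "sqrt (?f j) \<le> exp (real j - t) * sqrt (?f j)" by simp
  qed
  also have "\<dots> \<le> (\<Sum>j\<le>N. exp (real j - t) * sqrt (?f j))"
    by (intro sum_mono2) auto
  also have "\<dots> = exp (- t) * (\<Sum>j\<le>N. (N choose j) * (exp 1 * x) ^ j * y ^ (N - j))"
    unfolding f sum_distrib_left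
    by (intro sum.cong refl) (simp add: exp_diff power_mult_distrib exp_minus field_simps flip: exp_of_nat_mult)
  also have "\<dots> = exp (- t) * (exp 1 * x + y) ^ N"
    by (subst binomial_ring[symmetric]) simp
  also have "\<dots> \<le> exp (- t) * (exp (4 * x) * (x + y)) ^ N"
  proof (intro mult_left_mono power_mono)
    \<comment> \<open>Because \<open>y \<ge> 1/2\<close>, the increment
      \<open>(exp 1 - 1) * x\<close> is at most \<open>4 * x\<close> times \<open>x + y\<close>;
      this is the origin of the 4 in the cutoff.\<close>
    have "(exp 1 - 1) * x \<le> 2 * x" using exp_le x0 by (intro mult_right_mono) auto
    also have "\<dots> \<le> 4 * x * (x + y)"
    proof -
      have "4 * x * (1/2) \<le> 4 * x * (x + y)" using x0 y0 by (intro mult_left_mono) auto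
      then show ?thesis by simp
    qed
    finally have "exp 1 * x + y \<le> (1 + 4 * x) * (x + y)" by (simp add: algebra_simps)
    also have "\<dots> \<le> exp (4 * x) * (x + y)"
      using x0 y0 by (intro mult_right_mono exp_ge_add_one_self) auto
    finally show "exp 1 * x + y \<le> exp (4 * x) * (x + y)" .
  qed (use x0 y0 in auto)
  also have "\<dots> = S * exp (- 1)"
    by (simp add: power_mult_distrib S_def t_def exp_add[symmetric] mult_ac flip: exp_of_nat_mult)
  also have "\<dots> \<le> S * (1/2)"
  proof (intro mult_left_mono)
    have "exp (1::real) \<ge> 2" using exp_ge_add_one_self[of 1] by simp
    then show "exp (- 1) \<le> (1/2::real)" by (simp add: exp_minus field_simps)
  qed (use S0 in auto)
  finally have tail: "(\<Sum>j\<in>{..N} - J. sqrt (?f j)) \<le> S / 2" by simp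
  have "(\<Sum>j\<le>N. sqrt (?f j)) = (\<Sum>j\<in>J. sqrt (?f j)) + (\<Sum>j\<in>{..N} - J. sqrt (?f j))"
    by (intro sum.subset_diff[of J, THEN trans[OF _ add.commute]]) (auto simp: J_def)
  with tot tail have main: "S / 2 \<le> (\<Sum>j\<in>J. sqrt (?f j))" by simp
  have "card J \<le> card {..nat \<lfloor>t\<rfloor>}"
    by (intro card_mono) (auto simp: J_def le_nat_floor)
  then have "real (card J) \<le> real (nat \<lfloor>t\<rfloor>) + 1" by simp
  moreover have "real (nat \<lfloor>t\<rfloor>) \<le> t" using x0 by (intro of_nat_floor) (auto simp: t_def)
  ultimately have cJ: "real (card J) \<le> 4 * N * x + 3" by (simp add: t_def)
  have "(S / 2)\<^sup>2 \<le> (\<Sum>j\<in>J. sqrt (?f j) * 1)\<^sup>2"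
    using main S0 by (intro power_mono) auto
  also have "\<dots> \<le> (\<Sum>j\<in>J. (sqrt (?f j))\<^sup>2) * (\<Sum>j\<in>J. 1\<^sup>2)"
    by (rule Cauchy_Schwarz_ineq_sum)
  also have "\<dots> = (\<Sum>j\<in>J. ?f j) * real (card J)" by simp
  also have "\<dots> \<le> (\<Sum>j\<le>N. ?f j) * (4 * N * x + 3)"
    using cJ x0 by (intro mult_mono sum_mono2 sum_nonneg) (auto simp: J_def)
  finally have "S\<^sup>2 \<le> (\<Sum>j\<le>N. ?f j) * (4 * (4 * N * x + 3))"
    by (simp add: power_divide algebra_simps)
  moreover have "4 * (4 * N * x + 3) > 0" using x0 by (simp add: add_nonneg_pos)
  ultimately have "S\<^sup>2 / (4 * (4 * N * x + 3)) \<le> (\<Sum>j\<le>N. ?f j)"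
    by (subst pos_divide_le_eq)
  then show ?thesis by (simp add: S_def power_mult mult.commute flip: power_mult)
qed

lemma exp_le_one_minus:
  assumes "(w::real) \<in> {0..1/2}"
  shows "exp (- (w + 2 * w\<^sup>2)) \<le> 1 - w"
proof -
  have "- (w + 2 * w\<^sup>2) \<le> ln (1 - w)" using ln_one_minus_pos_lower_bound[of w] assms by auto
  then have "exp (- (w + 2 * w\<^sup>2)) \<le> exp (ln (1 - w))" by (subst exp_le_cancel_iff)
  also have "\<dots> = 1 - w" using assms by simp
  finally show ?thesis .
qed

subsection \<open>Balanced sign vectors\<close>

definition same_community :: "('a \<Rightarrow> 'b) \<Rightarrow> 'a set \<Rightarrow> bool" where
  "same_community \<sigma> e \<longleftrightarrow> (\<forall>u\<in>e. \<forall>v\<in>e. \<sigma> u = \<sigma> v)"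

definition positives :: "nat \<Rightarrow> (nat \<Rightarrow> int) \<Rightarrow> nat set" where
  "positives n \<sigma> = {v\<in>{1..n}. \<sigma> v = 1}"

definition negatives :: "nat \<Rightarrow> (nat \<Rightarrow> int) \<Rightarrow> nat set" where
  "negatives n \<sigma> = {v\<in>{1..n}. \<sigma> v = -1}"

lemma random_hypergraph_eq:
  "random_hypergraph n p q k \<sigma> =
    random_subset (nsets {1..n} k) (\<lambda>e. if same_community \<sigma> e then p else q)"
  by (simp add: random_hypergraph_def random_subset_def same_community_def)

declare finite_imp_finite_nsets [simp]

lemma sign_vectors_iff:
  "\<sigma> \<in> sign_vectors n \<longleftrightarrow>
    (\<forall>v\<in>{1..n}. \<sigma> v = 1 \<or> \<sigma> v = -1) \<and> (\<forall>v. v \<notin> {1..n} \<longrightarrow> \<sigma> v = 0)"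
  unfolding sign_vectors_def PiE_dflt_def mem_Collect_eq by (metis insert_iff singletonD)

lemma finite_sign_vectors: "finite (sign_vectors n)"
  unfolding sign_vectors_def by (intro finite_PiE_dflt) auto

lemma finite_balanced [simp]: "finite (balanced_sign_vectors n)"
  using finite_sign_vectors by (auto simp: balanced_sign_vectors_def)

lemma finite_positives [simp]: "finite (positives n \<sigma>)" "finite (negatives n \<sigma>)"
  by (auto simp: positives_def negatives_def)

lemma positives_subset: "positives n \<sigma> \<subseteq> {1..n}" "negatives n \<sigma> \<subseteq> {1..n}"
  by (auto simp: positives_def negatives_def)

lemma positives_disjoint: "positives n \<sigma> \<inter> negatives n \<sigma> = {}"
  by (auto simp: positives_def negatives_def)

lemma positives_Un: "\<sigma> \<in> sign_vectors n \<Longrightarrow> positives n \<sigma> \<union> negatives n \<sigma> = {1..n}"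
  unfolding sign_vectors_iff by (auto simp: positives_def negatives_def)

lemma balanced_iff:
  "\<sigma> \<in> balanced_sign_vectors (2 * m) \<longleftrightarrow>
    \<sigma> \<in> sign_vectors (2 * m) \<and> card (positives (2 * m) \<sigma>) = m \<and> card (negatives (2 * m) \<sigma>) = m"
proof -
  have "card (positives (2 * m) \<sigma>) + card (negatives (2 * m) \<sigma>) = 2 * m" if "\<sigma> \<in> sign_vectors (2 * m)"
    using card_Un_disjoint[of "positives (2*m) \<sigma>" "negatives (2*m) \<sigma>"] positives_disjoint[of "2*m" \<sigma>]
      positives_Un[OF that] by simp
  then show ?thesis
    unfolding balanced_sign_vectors_def by (auto simp: positives_def negatives_def)
qed

lemma balanced_uminus:
  "\<sigma> \<in> balanced_sign_vectors n \<Longrightarrow> (\<lambda>v. - \<sigma> v) \<in> balanced_sign_vectors n"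
proof -
  assume "\<sigma> \<in> balanced_sign_vectors n"
  moreover have "{v\<in>{1..n}. - \<sigma> v = 1} = {v\<in>{1..n}. \<sigma> v = -1}" "{v\<in>{1..n}. - \<sigma> v = -1} = {v\<in>{1..n}. \<sigma> v = 1}"
    by auto
  ultimately show ?thesis by (auto simp: balanced_sign_vectors_def sign_vectors_iff)
qed

lemma positives_uminus:
  "positives n (\<lambda>v. - \<sigma> v) = negatives n \<sigma>" "negatives n (\<lambda>v. - \<sigma> v) = positives n \<sigma>"
  by (auto simp: positives_def negatives_def)

lemma sign_vectors_eqI:
  assumes "\<sigma> \<in> sign_vectors n" "\<tau> \<in> sign_vectors n" "positives n \<sigma> = positives n \<tau>"
  shows "\<sigma> = \<tau>"
proof
  fix v
  have "v \<in> positives n \<sigma> \<longleftrightarrow> v \<in> positives n \<tau>" by (simp add: assms)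
  then show "\<sigma> v = \<tau> v"
    using assms(1,2)[unfolded sign_vectors_iff]
    by (cases "v \<in> {1..n}") (fastforce simp: positives_def)+
qed

lemma balanced_nonempty: "balanced_sign_vectors (2 * m) \<noteq> {}"
proof -
  define \<sigma> :: "nat \<Rightarrow> int" where "\<sigma> = (\<lambda>v. if v \<in> {1..2*m} then if v \<le> m then 1 else -1 else 0)"
  have "positives (2*m) \<sigma> = {1..m}" "negatives (2*m) \<sigma> = {m+1..2*m}"
    by (auto simp: positives_def negatives_def \<sigma>_def split: if_splits)
  then have "\<sigma> \<in> balanced_sign_vectors (2 * m)"
    unfolding balanced_iff by (auto simp: sign_vectors_iff \<sigma>_def)
  then show ?thesis by auto
qed

lemma error_prob_eq:
  "error_prob (2 * m) p q k est =
    (\<Sum>\<sigma>\<in>balanced_sign_vectors (2 * m).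
      measure_pmf.prob (random_hypergraph (2 * m) p q k \<sigma>) {H. est H \<notin> {\<sigma>, (\<lambda>v. - \<sigma> v)}})
    / card (balanced_sign_vectors (2 * m))"
proof -
  let ?B = "balanced_sign_vectors (2 * m)"
  let ?A = "{(\<sigma>, H). est H \<notin> {\<sigma>, (\<lambda>v. - \<sigma> v)}}"
  let ?M = "\<lambda>\<sigma>. map_pmf (\<lambda>H. (\<sigma>, H)) (random_hypergraph (2 * m) p q k \<sigma>)"
  have "finite (set_pmf (random_hypergraph (2 * m) p q k \<sigma>))" for \<sigma>
    unfolding random_hypergraph_eq using set_pmf_random_subset finite_subset by (metis finite_Pow_iff finite_imp_finite_nsets finite_atLeastAtMost)
  then have "error_prob (2 * m) p q k est = (\<Sum>\<sigma>\<in>?B. measure_pmf.expectation (?M \<sigma>) (indicator ?A) /\<^sub>R card ?B)"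
    unfolding error_prob_def HSBM_def
    by (subst pmf_expectation_bind_pmf_of_set[symmetric]) (auto simp: balanced_nonempty)
  also have "\<dots> = (\<Sum>\<sigma>\<in>?B. measure_pmf.prob (random_hypergraph (2 * m) p q k \<sigma>) {H. est H \<notin> {\<sigma>, (\<lambda>v. - \<sigma> v)}}) / card ?B"
    unfolding sum_divide_distrib by (intro sum.cong refl) (auto simp: vimage_def divide_inverse_commute)
  finally show ?thesis .
qed

section \<open>Stars, and the edges on which two balanced vectors disagree\<close>

definition star_edges :: "nat \<Rightarrow> 'a set \<Rightarrow> 'a set \<Rightarrow> 'a set set" where
  "star_edges k X Y = (\<lambda>(x, S). insert x S) ` (X \<times> nsets Y (k - 1))"

lemma card_star_edges:
  assumes "finite X" "finite Y" "X \<inter> Y = {}"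
  shows "card (star_edges k X Y) = card X * (card Y choose (k - 1))"
proof -
  have "inj_on (\<lambda>(x, S). insert x S) (X \<times> nsets Y (k - 1))"
  proof (intro inj_onI; clarify)
    fix x S x' S' assume *: "x \<in> X" "S \<in> nsets Y (k - 1)" "x' \<in> X" "S' \<in> nsets Y (k - 1)" "insert x S = insert x' S'"
    then have **: "S \<subseteq> Y" "S' \<subseteq> Y" by (auto simp: nsets_def)
    have "x = x'" using * ** assms(3) by blast
    moreover have "x \<notin> S" "x \<notin> S'" using * ** assms(3) by auto
    ultimately show "x = x' \<and> S = S'" using *(5) by (metis insert_ident)
  qed
  then show ?thesis
    unfolding star_edges_def by (subst card_image) (auto simp: card_cartesian_product card_nsets)
qed

lemma star_edges_nsets:
  assumes "X \<subseteq> V" "Y \<subseteq> V" "X \<inter> Y = {}" "k > 0"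
  shows "star_edges k X Y \<subseteq> nsets V k"
proof
  fix e assume "e \<in> star_edges k X Y"
  then obtain x S where "x \<in> X" "S \<subseteq> Y" "finite S" "card S = k - 1" "e = insert x S"
    by (auto simp: star_edges_def nsets_def)
  moreover from this have "x \<notin> S" using assms(3) by auto
  ultimately show "e \<in> nsets V k" using assms by (auto simp: nsets_def)
qed

text \<open>\<open>k \<ge> 2\<close> makes the part of the edge in \<open>Y\<close> nonempty. In the
  applications \<open>Y\<close> is constant under the sign vector, so comparing \<open>x\<close>
  with one \<open>y\<close> decides whether the edge is uniform.\<close>

lemma star_edgesE:
  assumes "e \<in> star_edges k X Y" "k \<ge> 2"
  obtains x y where "x \<in> X" "y \<in> Y" "x \<in> e" "y \<in> e" "e \<subseteq> insert x Y"
proof -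
  obtain x S where e: "x \<in> X" "S \<in> nsets Y (k - 1)" "e = insert x S"
    using assms(1) by (auto simp: star_edges_def)
  then have S: "S \<noteq> {}" "S \<subseteq> Y" using assms(2) by (auto simp: nsets_def)
  then obtain y where "y \<in> S" by blast
  with e S show ?thesis by (intro that[of x y]) auto
qed

lemma star_edges_disjoint:
  assumes "k \<ge> 2" "X \<inter> (X' \<union> Y') = {} \<or> Y \<inter> (X' \<union> Y') = {}"
  shows "star_edges k X Y \<inter> star_edges k X' Y' = {}"
proof -
  have False if e: "e \<in> star_edges k X Y" "e \<in> star_edges k X' Y'" for e
  proof -
    obtain x y where "x \<in> X" "y \<in> Y" "x \<in> e" "y \<in> e"
      using e(1) assms(1) by (blast elim: star_edgesE)
    moreover have "e \<subseteq> X' \<union> Y'" using e(2) assms(1) by (blast elim: star_edgesE)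
    ultimately show False using assms(2) by blast
  qed
  then show ?thesis by blast
qed

text \<open>Half the Hamming distance of two balanced vectors, since the mismatches in the other
  direction are equally many by \<open>overlap_cards\<close>.\<close>

definition swaps :: "nat \<Rightarrow> (nat \<Rightarrow> int) \<Rightarrow> (nat \<Rightarrow> int) \<Rightarrow> nat" where
  "swaps n \<sigma> \<tau> = card (positives n \<sigma> \<inter> negatives n \<tau>)"

text \<open>A two by two table whose row and column sums all equal \<open>m\<close> has a single
  free entry.\<close>

lemma overlap_cards:
  assumes "\<sigma> \<in> balanced_sign_vectors (2 * m)" "\<tau> \<in> balanced_sign_vectors (2 * m)"
  defines "t \<equiv> swaps (2 * m) \<sigma> \<tau>"
  shows "t \<le> m"
    "card (positives (2*m) \<sigma> \<inter> positives (2*m) \<tau>) = m - t"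
    "card (negatives (2*m) \<sigma> \<inter> positives (2*m) \<tau>) = t"
    "card (negatives (2*m) \<sigma> \<inter> negatives (2*m) \<tau>) = m - t"
proof -
  let ?P = "positives (2*m)" and ?N = "negatives (2*m)"
  have split: "card X = card (X \<inter> ?P \<rho>) + card (X \<inter> ?N \<rho>)"
    if "X \<subseteq> {1..2*m}" "\<rho> \<in> balanced_sign_vectors (2 * m)" for X \<rho>
  proof -
    have "X = (X \<inter> ?P \<rho>) \<union> (X \<inter> ?N \<rho>)"
      using that positives_Un[of \<rho> "2*m"] by (auto simp: balanced_iff)
    then have "card X = card ((X \<inter> ?P \<rho>) \<union> (X \<inter> ?N \<rho>))" by simp
    also have "\<dots> = card (X \<inter> ?P \<rho>) + card (X \<inter> ?N \<rho>)"
      using positives_disjoint[of "2*m" \<rho>] by (intro card_Un_disjoint) auto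
    finally show ?thesis .
  qed
  have 1: "m = card (?P \<sigma> \<inter> ?P \<tau>) + t"
    using split[OF positives_subset(1) assms(2), of \<sigma>] assms(1) by (simp add: balanced_iff t_def swaps_def)
  have 2: "m = card (?N \<sigma> \<inter> ?P \<tau>) + card (?N \<sigma> \<inter> ?N \<tau>)"
    using split[OF positives_subset(2) assms(2), of \<sigma>] assms(1) by (simp add: balanced_iff)
  have 3: "m = t + card (?N \<sigma> \<inter> ?N \<tau>)"
    using split[OF positives_subset(2) assms(1), of \<tau>] assms(2)
    by (simp add: balanced_iff t_def swaps_def Int_commute)
  from 1 2 3 show "t \<le> m" "card (?P \<sigma> \<inter> ?P \<tau>) = m - t" "card (?N \<sigma> \<inter> ?P \<tau>) = t"
    "card (?N \<sigma> \<inter> ?N \<tau>) = m - t" by linarith+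
qed

text \<open>Join a vertex that changes sides to \<open>k - 1\<close> vertices that stay on one
  common side. The edge is uniform under \<sigma> alone if they stay where the vertex comes from,
  and under \<tau> alone if they stay where it goes. Two directions of change times two sides give
  the factor 4.\<close>

lemma card_changed_edges:
  assumes "\<sigma> \<in> balanced_sign_vectors (2 * m)" "\<tau> \<in> balanced_sign_vectors (2 * m)" "k \<ge> 2"
  defines "t \<equiv> swaps (2 * m) \<sigma> \<tau>"
  shows "card {e\<in>nsets {1..2*m} k. same_community \<sigma> e \<noteq> same_community \<tau> e}
    \<ge> 4 * (t * ((m - t) choose (k - 1)))"
proof -
  let ?P = "positives (2*m)" and ?N = "negatives (2*m)"
  let ?D = "{e\<in>nsets {1..2*m} k. same_community \<sigma> e \<noteq> same_community \<tau> e}"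
  define PP PN NP NN where "PP = ?P \<sigma> \<inter> ?P \<tau>" and "PN = ?P \<sigma> \<inter> ?N \<tau>"
    and "NP = ?N \<sigma> \<inter> ?P \<tau>" and "NN = ?N \<sigma> \<inter> ?N \<tau>"
  note defs = PP_def PN_def NP_def NN_def positives_def negatives_def
  have c: "card PP = m - t" "card PN = t" "card NP = t" "card NN = m - t"
    using overlap_cards[OF assms(1,2)] by (auto simp: PP_def PN_def NP_def NN_def t_def swaps_def)
  have fin [simp]: "finite PP" "finite PN" "finite NP" "finite NN"
    by (auto simp: PP_def PN_def NP_def NN_def)
  have sub: "PP \<subseteq> {1..2*m}" "PN \<subseteq> {1..2*m}" "NP \<subseteq> {1..2*m}" "NN \<subseteq> {1..2*m}"
    by (auto simp: defs)
  have dj: "PP \<inter> PN = {}" "PP \<inter> NP = {}" "PP \<inter> NN = {}" "PN \<inter> NP = {}" "PN \<inter> NN = {}" "NP \<inter> NN = {}"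
    by (auto simp: defs)
  let ?A = "star_edges k PN PP" and ?B = "star_edges k NP NN"
  let ?C = "star_edges k PN NN" and ?F = "star_edges k NP PP"
  have dj': "?A \<inter> ?B = {}" "?A \<inter> ?C = {}" "?A \<inter> ?F = {}" "?B \<inter> ?C = {}" "?B \<inter> ?F = {}" "?C \<inter> ?F = {}"
    using dj by (intro star_edges_disjoint assms(3); blast)+
  have mem: "e \<in> ?D" if "e \<in> star_edges k X Y" "X \<in> {PN, NP}" "Y \<in> {PP, NN}" for e X Y
  proof -
    have "e \<in> nsets {1..2*m} k"
      using star_edges_nsets[of X "{1..2*m}" Y k] that assms(3) sub dj by (auto simp: Int_commute)
    moreover from that(1) obtain x y where xy: "x \<in> X" "y \<in> Y" "x \<in> e" "y \<in> e" "e \<subseteq> insert x Y"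
      using assms(3) by (elim star_edgesE)
    moreover have "same_community \<sigma> e \<noteq> same_community \<tau> e"
    proof (cases "\<sigma> x = \<sigma> y")
      case True
      then have "\<tau> x \<noteq> \<tau> y" using xy(1,2) that(2,3) by (auto simp: defs)
      moreover have "\<forall>u\<in>e. \<sigma> u = \<sigma> x" using True xy that(2,3) by (auto simp: defs)
      ultimately show ?thesis using xy(3,4) unfolding same_community_def by metis
    next
      case False
      then have "\<forall>u\<in>e. \<tau> u = \<tau> x" using xy that(2,3) by (auto simp: defs)
      then show ?thesis using False xy(3,4) unfolding same_community_def by metis
    qed
    ultimately show ?thesis by auto
  qed
  have f: "finite (star_edges k X Y)" if "finite X" "finite Y" for X Y :: "nat set"
    using that by (simp add: star_edges_def finite_imp_finite_nsets)
  have "card ?A = t * ((m - t) choose (k - 1))" "card ?B = t * ((m - t) choose (k - 1))"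
    "card ?C = t * ((m - t) choose (k - 1))" "card ?F = t * ((m - t) choose (k - 1))"
    using dj c by (subst card_star_edges; auto)+
  moreover have "card (?A \<union> ?B \<union> ?C \<union> ?F) = card ?A + card ?B + card ?C + card ?F"
    using dj' by (subst card_Un_disjoint; auto simp: f Int_Un_distrib2)+
  moreover have "card (?A \<union> ?B \<union> ?C \<union> ?F) \<le> card ?D"
    using mem by (intro card_mono) auto
  ultimately show ?thesis by linarith
qed

lemma prob_likelihood_swap_le:
  assumes "\<sigma> \<in> balanced_sign_vectors (2 * m)" "\<tau> \<in> balanced_sign_vectors (2 * m)" "k \<ge> 2"
    and pq: "p \<in> {0..1}" "q \<in> {0..1}"
  defines "t \<equiv> swaps (2 * m) \<sigma> \<tau>"
  shows "measure_pmf.prob (random_hypergraph (2 * m) p q k \<sigma>)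
      {H. pmf (random_hypergraph (2 * m) p q k \<sigma>) H \<le> pmf (random_hypergraph (2 * m) p q k \<tau>) H}
    \<le> exp (- (2 * t * ((m - t) choose (k - 1)) * (sqrt p - sqrt q)\<^sup>2))"
proof -
  let ?E = "nsets {1..2*m} k"
  let ?r = "\<lambda>\<sigma> e. if same_community \<sigma> e then p else q"
  let ?D = "{e\<in>?E. same_community \<sigma> e \<noteq> same_community \<tau> e}"
  define \<rho> where "\<rho> = sqrt (p * q) + sqrt ((1 - p) * (1 - q))"
  have \<rho>0: "\<rho> \<ge> 0" using pq by (auto simp: \<rho>_def)
  have "measure_pmf.prob (random_hypergraph (2 * m) p q k \<sigma>)
      {H. pmf (random_hypergraph (2 * m) p q k \<sigma>) H \<le> pmf (random_hypergraph (2 * m) p q k \<tau>) H}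
    \<le> (\<Prod>e\<in>?E. sqrt (?r \<sigma> e * ?r \<tau> e) + sqrt ((1 - ?r \<sigma> e) * (1 - ?r \<tau> e)))"
    unfolding random_hypergraph_eq using pq by (intro prob_random_subset_likelihood_le) auto
  \<comment> \<open>An edge outside \<open>?D\<close> has the same rate \<open>r\<close> under both
    vectors and contributes \<open>r + (1 - r) = 1\<close>.\<close>
  also have "\<dots> = (\<Prod>e\<in>?E. if e \<in> ?D then \<rho> else 1)"
    using pq by (intro prod.cong) (auto simp: \<rho>_def mult.commute)
  also have "\<dots> = \<rho> ^ card ?D"
    by (subst prod.inter_restrict[symmetric]) (auto simp: Int_def)
  also have "\<dots> \<le> exp (- ((sqrt p - sqrt q)\<^sup>2 / 2)) ^ card ?D"
  proof (intro power_mono \<rho>0)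
    have "\<rho> \<le> 1 + - ((sqrt p - sqrt q)\<^sup>2 / 2)" using bhattacharyya_le[OF pq] by (simp add: \<rho>_def)
    also have "\<dots> \<le> exp (- ((sqrt p - sqrt q)\<^sup>2 / 2))" by (rule exp_ge_add_one_self)
    finally show "\<rho> \<le> exp (- ((sqrt p - sqrt q)\<^sup>2 / 2))" .
  qed
  also have "\<dots> = exp (- (card ?D * ((sqrt p - sqrt q)\<^sup>2 / 2)))"
    by (simp flip: exp_of_nat_mult)
  also have "\<dots> \<le> exp (- (real (4 * (t * ((m - t) choose (k - 1)))) * ((sqrt p - sqrt q)\<^sup>2 / 2)))"
    using card_changed_edges[OF assms(1-3)] unfolding exp_le_cancel_iff neg_le_iff_le t_def
    by (intro mult_right_mono of_nat_mono) auto
  finally show ?thesis by (simp add: mult_ac)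
qed

lemma same_community_uminus: "same_community (\<lambda>v. - \<sigma> v :: int) = same_community \<sigma>"
  by (auto simp: same_community_def fun_eq_iff)

lemma random_hypergraph_uminus:
  "random_hypergraph n p q k (\<lambda>v. - \<sigma> v) = random_hypergraph n p q k \<sigma>"
  by (simp add: random_hypergraph_eq same_community_uminus)

lemma swaps_eq_0:
  assumes "\<sigma> \<in> balanced_sign_vectors (2 * m)" "\<tau> \<in> balanced_sign_vectors (2 * m)"
    "swaps (2 * m) \<sigma> \<tau> = 0"
  shows "\<sigma> = \<tau>"
proof -
  let ?P = "positives (2*m)"
  have "?P \<sigma> \<inter> negatives (2*m) \<tau> = {}" using assms(3) by (simp add: swaps_def)
  then have "?P \<sigma> \<subseteq> ?P \<tau>"
    using positives_subset[of "2*m" \<sigma>] positives_Un[of \<tau> "2*m"] assms(2) by (auto simp: balanced_iff)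
  then have "?P \<sigma> = ?P \<tau>"
    using assms(1,2) by (intro card_subset_eq) (auto simp: balanced_iff)
  then show ?thesis using assms(1,2) by (intro sign_vectors_eqI[of _ "2*m"]) (auto simp: balanced_iff)
qed

text \<open>Hence \<tau> or its negation is within \<open>m div 2\<close> swaps of \<sigma>, which
  halves the range of the union bound.\<close>

lemma swaps_uminus:
  assumes "\<sigma> \<in> balanced_sign_vectors (2 * m)" "\<tau> \<in> balanced_sign_vectors (2 * m)"
  shows "swaps (2 * m) \<sigma> (\<lambda>v. - \<tau> v) = m - swaps (2 * m) \<sigma> \<tau>"
  using overlap_cards(2)[OF assms] by (simp add: swaps_def positives_uminus)

text \<open>Given \<sigma>, the vector \<tau> is determined by the \<open>t\<close> positives that
  it turns negative and the \<open>t\<close> negatives that it turns positive.\<close>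

lemma card_swaps_le:
  assumes "\<sigma> \<in> balanced_sign_vectors (2 * m)"
  shows "card {\<tau>\<in>balanced_sign_vectors (2 * m). swaps (2 * m) \<sigma> \<tau> = t} \<le> (m choose t)\<^sup>2"
proof -
  let ?P = "positives (2*m)" and ?N = "negatives (2*m)"
  let ?T = "{\<tau>\<in>balanced_sign_vectors (2 * m). swaps (2 * m) \<sigma> \<tau> = t}"
  let ?f = "\<lambda>\<tau>. (?P \<sigma> \<inter> ?N \<tau>, ?N \<sigma> \<inter> ?P \<tau>)"
  have "inj_on ?f ?T"
  proof (intro inj_onI)
    fix \<tau> \<tau>' assume *: "\<tau> \<in> ?T" "\<tau>' \<in> ?T" "?f \<tau> = ?f \<tau>'"
    have P: "?P \<rho> = (?N \<sigma> \<inter> ?P \<rho>) \<union> (?P \<sigma> - (?P \<sigma> \<inter> ?N \<rho>))" if "\<rho> \<in> ?T" for \<rho>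
    proof -
      have "?P \<rho> \<union> ?N \<rho> = ?P \<sigma> \<union> ?N \<sigma>"
        using that assms by (simp add: balanced_iff positives_Un)
      then show ?thesis using positives_disjoint[of "2*m" \<rho>] by blast
    qed
    have "?P \<tau> = (?N \<sigma> \<inter> ?P \<tau>) \<union> (?P \<sigma> - (?P \<sigma> \<inter> ?N \<tau>))" by (rule P[OF *(1)])
    also have "\<dots> = (?N \<sigma> \<inter> ?P \<tau>') \<union> (?P \<sigma> - (?P \<sigma> \<inter> ?N \<tau>'))" using *(3) by simp
    also have "\<dots> = ?P \<tau>'" by (rule P[OF *(2), symmetric])
    finally have "?P \<tau> = ?P \<tau>'" .
    then show "\<tau> = \<tau>'" using *(1,2) by (intro sign_vectors_eqI[of _ "2*m"]) (auto simp: balanced_iff)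
  qed
  moreover have "?f ` ?T \<subseteq> nsets (?P \<sigma>) t \<times> nsets (?N \<sigma>) t"
  proof
    fix x assume "x \<in> ?f ` ?T"
    then obtain \<tau> where "\<tau> \<in> ?T" "x = ?f \<tau>" by blast
    then show "x \<in> nsets (?P \<sigma>) t \<times> nsets (?N \<sigma>) t"
      using overlap_cards(3)[OF assms, of \<tau>] by (simp add: nsets_def swaps_def)
  qed
  ultimately have "card ?T \<le> card (nsets (?P \<sigma>) t \<times> nsets (?N \<sigma>) t)"
    by (intro card_inj_on_le) simp_all
  then show ?thesis
    using assms by (simp add: card_cartesian_product card_nsets balanced_iff power2_eq_square)
qed

subsection \<open>The maximum likelihood estimator\<close>

text \<open>The constant value on odd \<open>n\<close> only serves to make this a total estimator.\<close>

definition mle :: "nat \<Rightarrow> real \<Rightarrow> real \<Rightarrow> nat \<Rightarrow> nat set set \<Rightarrow> nat \<Rightarrow> int" where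
  "mle n p q k H = (if even n
     then SOME \<sigma>. \<sigma> \<in> balanced_sign_vectors n \<and> (\<forall>\<tau>\<in>balanced_sign_vectors n.
        pmf (random_hypergraph n p q k \<tau>) H \<le> pmf (random_hypergraph n p q k \<sigma>) H)
     else (\<lambda>v. if v \<in> {1..n} then 1 else 0))"

lemma mle_maximal:
  "mle (2 * m) p q k H \<in> balanced_sign_vectors (2 * m) \<and> (\<forall>\<tau>\<in>balanced_sign_vectors (2 * m).
    pmf (random_hypergraph (2 * m) p q k \<tau>) H \<le>
    pmf (random_hypergraph (2 * m) p q k (mle (2 * m) p q k H)) H)"
proof -
  let ?L = "\<lambda>\<sigma>. pmf (random_hypergraph (2 * m) p q k \<sigma>) H" and ?B = "balanced_sign_vectors (2 * m)"
  have "Max (?L ` ?B) \<in> ?L ` ?B" by (intro Max_in) (auto simp: balanced_nonempty)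
  then obtain \<sigma> where "\<sigma> \<in> ?B" "?L \<sigma> = Max (?L ` ?B)" by auto
  then have "\<sigma> \<in> ?B \<and> (\<forall>\<tau>\<in>?B. ?L \<tau> \<le> ?L \<sigma>)" by auto
  then have "\<exists>\<sigma>. \<sigma> \<in> ?B \<and> (\<forall>\<tau>\<in>?B. ?L \<tau> \<le> ?L \<sigma>)" by blast
  from someI_ex[OF this] show ?thesis by (simp add: mle_def)
qed

lemma mle_sign_vectors: "mle n p q k H \<in> sign_vectors n"
proof (cases "even n")
  case True
  then obtain m where "n = 2 * m" by (elim evenE)
  then show ?thesis using mle_maximal[of m] by (auto simp: balanced_sign_vectors_def)
qed (auto simp: mle_def sign_vectors_iff)

lemma error_prob_mle_le:
  assumes "k \<ge> 2" "p \<in> {0..1}" "q \<in> {0..1}"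
  shows "error_prob (2 * m) p q k (mle (2 * m) p q k) \<le>
    (\<Sum>t\<in>{1..m div 2}. (real (m choose t))\<^sup>2 *
      exp (- (2 * t * ((m - t) choose (k - 1)) * (sqrt p - sqrt q)\<^sup>2)))"
proof -
  let ?c = "\<lambda>t. (real (m choose t))\<^sup>2"
    and ?b = "\<lambda>t. exp (- (2 * t * ((m - t) choose (k - 1)) * (sqrt p - sqrt q)\<^sup>2))"
  let ?B = "balanced_sign_vectors (2 * m)" and ?R = "random_hypergraph (2 * m) p q k"
  let ?L = "\<lambda>\<sigma> H. pmf (?R \<sigma>) H" and ?e = "mle (2 * m) p q k" and ?s = "swaps (2 * m)"
  have *: "measure_pmf.prob (?R \<sigma>) {H. ?e H \<notin> {\<sigma>, (\<lambda>v. - \<sigma> v)}} \<le> (\<Sum>t\<in>{1..m div 2}. ?c t * ?b t)"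
    if \<sigma>: "\<sigma> \<in> ?B" for \<sigma>
  proof -
    let ?T = "\<lambda>t. {\<tau>\<in>?B. ?s \<sigma> \<tau> = t}"
    have "{H. ?e H \<notin> {\<sigma>, (\<lambda>v. - \<sigma> v)}} \<subseteq> (\<Union>t\<in>{1..m div 2}. \<Union>\<tau>\<in>?T t. {H. ?L \<sigma> H \<le> ?L \<tau> H})"
    proof
      fix H assume "H \<in> {H. ?e H \<notin> {\<sigma>, (\<lambda>v. - \<sigma> v)}}"
      then have ne: "?e H \<noteq> \<sigma>" "(\<lambda>v. - ?e H v) \<noteq> \<sigma>" by auto
      have e: "?e H \<in> ?B" "?L \<sigma> H \<le> ?L (?e H) H" using mle_maximal \<sigma> by auto
      have e': "(\<lambda>v. - ?e H v) \<in> ?B" "?L \<sigma> H \<le> ?L (\<lambda>v. - ?e H v) H"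
        using e balanced_uminus by (auto simp: random_hypergraph_uminus)
      \<comment> \<open>Negating the estimate changes neither its likelihood nor whether it is
        correct, so the closer of the two signs can serve as competitor.\<close>
      obtain \<tau> where \<tau>: "\<tau> \<in> ?B" "?L \<sigma> H \<le> ?L \<tau> H" "\<tau> \<noteq> \<sigma>" "?s \<sigma> \<tau> \<le> m div 2"
      proof (cases "?s \<sigma> (?e H) \<le> m div 2")
        case True
        then show ?thesis using that e ne by blast
      next
        case False
        then have "?s \<sigma> (\<lambda>v. - ?e H v) \<le> m div 2" using swaps_uminus[OF \<sigma> e(1)] by auto
        then show ?thesis using that e' ne by blast
      qed
      moreover have "?s \<sigma> \<tau> \<noteq> 0" using swaps_eq_0[OF \<sigma> \<tau>(1)] \<tau>(3) by auto
      ultimately show "H \<in> (\<Union>t\<in>{1..m div 2}. \<Union>\<tau>\<in>?T t. {H. ?L \<sigma> H \<le> ?L \<tau> H})"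
        by (intro UN_I[of "?s \<sigma> \<tau>"] UN_I[of \<tau>]) auto
    qed
    then have "measure_pmf.prob (?R \<sigma>) {H. ?e H \<notin> {\<sigma>, (\<lambda>v. - \<sigma> v)}}
        \<le> measure_pmf.prob (?R \<sigma>) (\<Union>t\<in>{1..m div 2}. \<Union>\<tau>\<in>?T t. {H. ?L \<sigma> H \<le> ?L \<tau> H})"
      by (intro measure_pmf.finite_measure_mono) auto
    also have "\<dots> \<le> (\<Sum>t\<in>{1..m div 2}. measure_pmf.prob (?R \<sigma>) (\<Union>\<tau>\<in>?T t. {H. ?L \<sigma> H \<le> ?L \<tau> H}))"
      by (intro measure_pmf.finite_measure_subadditive_finite) auto
    also have "\<dots> \<le> (\<Sum>t\<in>{1..m div 2}. \<Sum>\<tau>\<in>?T t. measure_pmf.prob (?R \<sigma>) {H. ?L \<sigma> H \<le> ?L \<tau> H})"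
      by (intro sum_mono measure_pmf.finite_measure_subadditive_finite) auto
    also have "\<dots> \<le> (\<Sum>t\<in>{1..m div 2}. \<Sum>\<tau>\<in>?T t. ?b t)"
      using prob_likelihood_swap_le[OF \<sigma> _ assms] by (intro sum_mono) auto
    also have "\<dots> \<le> (\<Sum>t\<in>{1..m div 2}. ?c t * ?b t)"
    proof (intro sum_mono)
      fix t
      have "real (card (?T t)) \<le> ?c t" using card_swaps_le[OF \<sigma>, of t] by (metis of_nat_le_iff of_nat_power)
      then show "(\<Sum>\<tau>\<in>?T t. ?b t) \<le> ?c t * ?b t" by (simp add: mult_right_mono)
    qed
    finally show ?thesis .
  qed
  have "error_prob (2 * m) p q k ?e \<le> (\<Sum>\<sigma>\<in>?B. \<Sum>t\<in>{1..m div 2}. ?c t * ?b t) / card ?B"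
    unfolding error_prob_eq by (intro divide_right_mono sum_mono *) auto
  then show ?thesis by (simp add: balanced_nonempty)
qed

section \<open>Binomial ratios, edge probabilities and the asymptotics of the union bound\<close>

lemma tendsto_even_sequentiallyI:
  "(f \<longlongrightarrow> l) sequentially \<Longrightarrow> (f \<longlongrightarrow> l) even_sequentially"
  unfolding even_sequentially_def by (rule tendsto_mono[OF inf_le1])

text \<open>Every factor of the falling factorial is at least \<open>a - j\<close>. With truncated
  subtraction the case \<open>a < j\<close> reads 0 on both sides.\<close>

lemma pow_le_fact_binomial: "(a - j) ^ j \<le> fact j * (a choose j)"
proof (induction j)
  case (Suc j)
  have "(a - Suc j) ^ Suc j \<le> (a - j) * (a - j) ^ j" by (simp add: mult_le_mono power_mono)
  also have "\<dots> \<le> (a - j) * (fact j * (a choose j))" using Suc by simp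
  also have "\<dots> = fact j * ((a - j) * (a choose j))" by simp
  also have "\<dots> = fact j * (Suc j * (a choose Suc j))"
    by (simp only: binomial_absorb_comp binomial_absorption)
  also have "\<dots> = fact (Suc j) * (a choose Suc j)" by (simp add: algebra_simps)
  finally show ?case .
qed auto

text \<open>Source of the factor \<open>1 / 2 ^ (k - 1)\<close> in the threshold: for
  \<open>a\<close> near \<open>n / 2\<close> and \<open>j = k - 1\<close> the bound is near that
  value. The factorials cancel, and falling factorials are compared with powers.\<close>

lemma binomial_ratio_ge:
  assumes "n > j" "a \<ge> j"
  shows "((real a - real j) / real n) ^ j \<le> real (a choose j) / real ((n - 1) choose j)"
proof -
  have "fact j * ((n - 1) choose j) \<le> (n - 1) ^ j"
    using binomial_fact_pow[of "n - 1" j] by (simp add: mult.commute)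
  also have "\<dots> \<le> n ^ j" by (intro power_mono) auto
  finally have 1: "real (fact j * ((n - 1) choose j)) \<le> real n ^ j"
    unfolding of_nat_power[symmetric] of_nat_le_iff .
  have 2: "(real a - real j) ^ j \<le> real (fact j * (a choose j))"
    using pow_le_fact_binomial[of a j] assms(2) by (metis of_nat_diff of_nat_le_iff of_nat_power)
  have "((real a - real j) / real n) ^ j = (real a - real j) ^ j / real n ^ j" by (simp add: power_divide)
  also have "\<dots> \<le> real (fact j * (a choose j)) / real (fact j * ((n - 1) choose j))"
    using 1 2 assms by (intro frac_le) auto
  finally show ?thesis by simp
qed

lemma binomial_ratio_le:
  assumes "n - 1 > j" "a \<le> m" 
  shows "real (a choose j) / real ((n - 1) choose j) \<le> (real m / (real n - 1 - real j)) ^ j"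
proof -
  have "fact j * (a choose j) \<le> a ^ j"
    using binomial_fact_pow[of a j] by (simp add: mult.commute)
  also have "\<dots> \<le> m ^ j" using assms by (intro power_mono) auto
  finally have 1: "real (fact j * (a choose j)) \<le> real m ^ j"
    unfolding of_nat_power[symmetric] of_nat_le_iff .
  have "real (n - 1 - j) = real n - 1 - real j" using assms by (simp add: of_nat_diff)
  then have 2: "(real n - 1 - real j) ^ j \<le> real (fact j * ((n - 1) choose j))"
    using pow_le_fact_binomial[of "n - 1" j] by (metis of_nat_le_iff of_nat_power)
  have "real (a choose j) / real ((n - 1) choose j) =
     real (fact j * (a choose j)) / real (fact j * ((n - 1) choose j))" by simp
  also have "\<dots> \<le> real m ^ j / (real n - 1 - real j) ^ j"
    using 1 2 assms by (intro frac_le) auto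
  finally show ?thesis by (simp add: power_divide)
qed

text \<open>The binomial coefficient is at least \<open>((n - 1) / (k - 1)) ^ (k - 1)\<close>, and
  one factor of this power is enough: for every \<open>k \<ge> 2\<close> the rates are at most of
  order log n / n.\<close>

lemma edge_prob_le:
  assumes "k \<ge> 2" "n \<ge> k" "c \<ge> 0"
  shows "c * ln (real n) / real ((n - 1) choose (k - 1)) \<le> c * (real k - 1) * (ln (real n) / (real n - 1))"
proof -
  let ?j = "k - 1" and ?C = "real ((n - 1) choose (k - 1))"
  have "real (n - 1) / ?j \<ge> 1" using assms by simp
  then have "real (n - 1) / ?j \<le> (real (n - 1) / ?j) ^ ?j"
    using assms(1) by (intro self_le_power) auto
  also have "\<dots> \<le> ?C" using assms by (intro binomial_ge_n_over_k_pow_k) auto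
  finally have *: "real (n - 1) / ?j \<le> ?C" .
  have "c * ln (real n) / ?C \<le> c * ln (real n) / (real (n - 1) / ?j)"
    using assms * by (intro divide_left_mono) (auto intro!: mult_nonneg_nonneg divide_pos_pos mult_pos_pos)
  also have "\<dots> = c * (real k - 1) * (ln (real n) / (real n - 1))"
    using assms by (simp add: of_nat_diff)
  finally show ?thesis .
qed

text \<open>With \<epsilon> = 1 it turns the rates into genuine probabilities; with a small
  \<epsilon> it controls the second order losses in the exponent of the tie probability.\<close>

lemma edge_prob_small:
  assumes "k \<ge> 2" "c > 0" "\<epsilon> > 0"
  shows "eventually (\<lambda>n. c * ln (real n) / real ((n - 1) choose (k - 1)) \<in> {0..\<epsilon>}) sequentially"
proof -
  have "((\<lambda>n. c * (real k - 1) * (ln (real n) / (real n - 1))) \<longlongrightarrow> c * (real k - 1) * 0) sequentially"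
    by (intro tendsto_mult tendsto_const) real_asymp
  then have "eventually (\<lambda>n. c * (real k - 1) * (ln (real n) / (real n - 1)) < \<epsilon>) sequentially"
    using assms by (intro order_tendstoD) auto
  then show ?thesis using eventually_ge_at_top[of k]
  proof eventually_elim
    case (elim n)
    then have "c * ln (real n) / real ((n - 1) choose (k - 1)) \<le> \<epsilon>"
      using edge_prob_le[of k n c] assms by linarith
    moreover have "c * ln (real n) / real ((n - 1) choose (k - 1)) \<ge> 0"
      using assms elim by auto
    ultimately show ?case by auto
  qed
qed

lemma sum_power_le:
  assumes "0 \<le> x" "x \<le> (1/2::real)"
  shows "(\<Sum>t\<in>{1..M}. x ^ t) \<le> 2 * x"
proof -
  have "(\<Sum>t\<in>{1..M}. x ^ t) * (1 - x) \<le> x - x ^ Suc M"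
    by (induction M) (simp_all add: algebra_simps)
  then have "(\<Sum>t\<in>{1..M}. x ^ t) * (1 - x) \<le> x"
    using zero_le_power[OF assms(1), of "Suc M"] by linarith
  moreover have "(\<Sum>t\<in>{1..M}. x ^ t) * (1/2) \<le> (\<Sum>t\<in>{1..M}. x ^ t) * (1 - x)"
    using assms by (intro mult_left_mono sum_nonneg) auto
  ultimately show ?thesis by simp
qed

lemma sqrt_diff_scaled:
  assumes "x \<ge> 0" "\<alpha> \<ge> 0" "\<beta> \<ge> 0"
  shows "(sqrt (\<alpha> * x) - sqrt (\<beta> * x))\<^sup>2 = (sqrt \<alpha> - sqrt \<beta>)\<^sup>2 * x"
proof -
  have "(sqrt (\<alpha> * x) - sqrt (\<beta> * x))\<^sup>2 = ((sqrt \<alpha> - sqrt \<beta>) * sqrt x)\<^sup>2"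
    by (simp add: real_sqrt_mult left_diff_distrib)
  then show ?thesis using assms by (simp add: power_mult_distrib)
qed

text \<open>Few swaps: the counting factor \<open>m ^ (2 * t)\<close> is beaten because
  the exponent per swap exceeds 2.
  Many swaps: the counting factor is only \<open>4 ^ m\<close>, exponential in \<open>t\<close>.\<close>

lemma mle_union_bound_le:
  fixes m k :: nat and \<kappa> \<delta> c :: real
  defines "n \<equiv> 2 * m" and "j \<equiv> k - 1"
  defines "x \<equiv> real n powr (2 - c)" and "y \<equiv> 4 powr (1 / \<delta>) * real n powr (- (2 * \<kappa> / 8 ^ j))"
  assumes "k \<ge> 2" "m > 0" "\<kappa> \<ge> 0" and \<delta>: "0 < \<delta>" "\<delta> < 1/4"
    and c: "c \<le> 2 * \<kappa> * (1/2 - \<delta>) ^ j"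
    and n: "8 * real j \<le> real n" "2 * real j \<le> \<delta> * real n"
    and x: "x \<le> 1/2" and y: "y \<le> 1/2"
  shows "(\<Sum>t\<in>{1..m div 2}. (real (m choose t))\<^sup>2 *
      exp (- (2 * t * ((m - t) choose j) * (\<kappa> * (ln n / ((n - 1) choose j)))))) \<le> 2 * x + 2 * y"
proof -
  let ?f = "\<lambda>t. (real (m choose t))\<^sup>2 * exp (- (2 * t * ((m - t) choose j) * (\<kappa> * (ln n / ((n - 1) choose j)))))"
  have n0: "real n = 2 * real m" "real n \<ge> 2" "ln n \<ge> 0" using assms by (auto simp: n_def)
  have "j \<ge> 1" using assms by (simp add: j_def)
  have nj: "n > j" using n \<open>j \<ge> 1\<close> by linarith
  \<comment> \<open>A lower bound \<open>w\<close> on the binomial ratio makes each swap worth a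
    factor \<open>n powr - (2 * \<kappa> * w)\<close>, so that the union bound becomes a geometric
    series in \<open>t\<close>.\<close>
  have decay: "exp (- (2 * t * ((m - t) choose j) * (\<kappa> * (ln n / ((n - 1) choose j))))) \<le> (real n powr - (2 * \<kappa> * w)) ^ t"
    if "w \<le> real ((m - t) choose j) / real ((n - 1) choose j)" for t w
  proof -
    have "w * (2 * real t * \<kappa> * ln n) \<le> real ((m - t) choose j) / real ((n - 1) choose j) * (2 * real t * \<kappa> * ln n)"
      using that n0 assms(7) by (intro mult_right_mono) auto
    then have "exp (- (2 * t * ((m - t) choose j) * (\<kappa> * (ln n / ((n - 1) choose j))))) \<le> exp (real t * (- (2 * \<kappa> * w) * ln n))"
      by (simp add: mult_ac)
    also have "\<dots> = exp (- (2 * \<kappa> * w) * ln n) ^ t" by (rule exp_of_nat_mult)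
    also have "\<dots> = (real n powr - (2 * \<kappa> * w)) ^ t"
      using n0 by (simp add: powr_def)
    finally show ?thesis .
  qed
  have small: "?f t \<le> x ^ t" if t: "t \<le> m div 2" "real t \<le> \<delta> * m" for t
  proof -
    have aj: "j \<le> m - t" using t n n0 by linarith
    have tm: "t \<le> m" using t by simp
    have r: "real (m - t) - real j = real m - real t - real j" using tm by (simp add: of_nat_diff)
    \<comment> \<open>Half of the loss \<delta> pays for the \<open>t \<le> \<delta> * m\<close>
      swaps, the other half for \<open>j\<close>, by
      \<open>2 * j \<le> \<delta> * n\<close>.\<close>
    have "(1/2 - \<delta>) * real n \<le> real (m - t) - real j"
      unfolding r using t n n0 by (simp add: algebra_simps)
    then have "1/2 - \<delta> \<le> (real (m - t) - real j) / real n" using n0 by (simp add: field_simps)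
    then have "(1/2 - \<delta>) ^ j \<le> ((real (m - t) - real j) / real n) ^ j"
      using \<delta> by (intro power_mono) auto
    also have "\<dots> \<le> real ((m - t) choose j) / real ((n - 1) choose j)"
      by (rule binomial_ratio_ge[OF nj aj])
    finally have "?f t \<le> (real (m choose t))\<^sup>2 * (real n powr - (2 * \<kappa> * (1/2 - \<delta>) ^ j)) ^ t"
      by (intro mult_left_mono decay) auto
    also have "\<dots> \<le> (real n ^ t)\<^sup>2 * (real n powr - c) ^ t"
    proof (intro mult_mono power_mono powr_mono)
      have "m choose t \<le> m ^ t" using tm by (rule binomial_le_pow)
      also have "\<dots> \<le> n ^ t" by (intro power_mono) (auto simp: n_def)
      finally show "real (m choose t) \<le> real n ^ t" by (metis of_nat_le_iff of_nat_power)
    qed (use c n0 in auto)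
    also have "\<dots> = ((real n)\<^sup>2 * real n powr - c) ^ t"
      by (simp only: power_mult_distrib power_mult[symmetric] mult.commute)
    also have "(real n)\<^sup>2 = real n powr 2" using n0 by simp
    also have "real n powr 2 * real n powr - c = x" by (simp only: x_def powr_add[symmetric]) simp
    finally show ?thesis .
  qed
  have large: "?f t \<le> y ^ t" if t: "t \<le> m div 2" "real t > \<delta> * m" for t
  proof -
    have aj: "j \<le> m - t" using t n n0 by linarith
    have tm: "t \<le> m" using t by simp
    have r: "real (m - t) - real j = real m - real t - real j" using tm by (simp add: of_nat_diff)
    have "2 * real t \<le> real m" using t by linarith
    \<comment> \<open>Here \<open>m - t\<close> is only known to be at least \<open>n / 4\<close>,
      and \<open>j \<le> n / 8\<close> takes away half of that.\<close>
    then have "1/8 * real n \<le> real (m - t) - real j"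
      unfolding r using n n0 by (simp add: algebra_simps)
    then have "1/8 \<le> (real (m - t) - real j) / real n" using n0 by (simp add: field_simps)
    then have "(1/8) ^ j \<le> ((real (m - t) - real j) / real n) ^ j"
      using \<delta> by (intro power_mono) auto
    also have "\<dots> \<le> real ((m - t) choose j) / real ((n - 1) choose j)"
      by (rule binomial_ratio_ge[OF nj aj])
    finally have "?f t \<le> (real (m choose t))\<^sup>2 * (real n powr - (2 * \<kappa> * (1/8) ^ j)) ^ t"
      by (intro mult_left_mono decay) auto
    also have "\<dots> \<le> (4 powr (1 / \<delta>)) ^ t * (real n powr - (2 * \<kappa> * (1/8) ^ j)) ^ t"
    proof (intro mult_right_mono)
      \<comment> \<open>Since \<open>m < t / \<delta>\<close>, the crude count \<open>4 ^ m\<close>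
        is at most a constant to the power \<open>t\<close>, which any negative power of
        \<open>n\<close> per swap beats.\<close>
      have "real (m choose t) \<le> real (2 ^ m)"
        by (intro of_nat_mono binomial_le_pow2)
      then have "(real (m choose t))\<^sup>2 \<le> (2 ^ m)\<^sup>2" by (intro power_mono) auto
      also have "\<dots> = (2\<^sup>2) ^ m" by (simp only: power_mult[symmetric] mult.commute)
      also have "\<dots> = 4 powr real m" by (simp add: powr_realpow)
      also have "\<dots> \<le> 4 powr (1 / \<delta> * real t)"
        using t \<delta> by (intro powr_mono) (auto simp: field_simps)
      also have "\<dots> = (4 powr (1 / \<delta>)) powr real t" by (simp only: powr_powr)
      also have "\<dots> = (4 powr (1 / \<delta>)) ^ t" by (simp add: powr_realpow)
      finally show "(real (m choose t))\<^sup>2 \<le> (4 powr (1 / \<delta>)) ^ t" .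
    qed auto
    also have "\<dots> = y ^ t" by (simp add: y_def power_mult_distrib power_one_over)
    finally show ?thesis .
  qed
  have x0: "x \<ge> 0" and y0: "y \<ge> 0" by (auto simp: x_def y_def)
  have "(\<Sum>t\<in>{1..m div 2}. ?f t) \<le> (\<Sum>t\<in>{1..m div 2}. x ^ t + y ^ t)"
  proof (intro sum_mono)
    fix t assume "t \<in> {1..m div 2}"
    then show "?f t \<le> x ^ t + y ^ t"
      using small[of t] large[of t] zero_le_power[OF x0, of t] zero_le_power[OF y0, of t]
      by (cases "real t \<le> \<delta> * m") simp_all
  qed
  also have "\<dots> \<le> 2 * x + 2 * y"
    unfolding sum.distrib by (intro add_mono sum_power_le x y x0 y0)
  finally show ?thesis .
qed

lemma exact_recovery_possible_above_threshold:
  fixes k :: nat and \<alpha> \<beta> :: real and p q :: "nat \<Rightarrow> real"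
  assumes "k \<ge> 2" "\<alpha> > 0" "\<beta> > 0"
    and p: "\<And>n. even n \<Longrightarrow> n > 0 \<Longrightarrow> p n = \<alpha> * ln (real n) / real ((n - 1) choose (k - 1))"
    and q: "\<And>n. even n \<Longrightarrow> n > 0 \<Longrightarrow> q n = \<beta> * ln (real n) / real ((n - 1) choose (k - 1))"
    and I: "recovery_threshold k \<alpha> \<beta> > 1"
  shows "exact_recovery_possible k p q"
proof -
  define \<kappa> where "\<kappa> = (sqrt \<alpha> - sqrt \<beta>)\<^sup>2"
  define j where "j = k - 1"
  \<comment> \<open>At \<delta> = 0 the exponent per swap is twice the recovery threshold and
    exceeds 2; by continuity some positive \<delta> keeps it above 2.\<close>
  have "((\<lambda>\<delta>. 2 * \<kappa> * (1/2 - \<delta>) ^ j) \<longlongrightarrow> 2 * \<kappa> * (1/2 - 0) ^ j) (at_right 0)"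
    by (intro tendsto_intros)
  moreover have "2 * \<kappa> * (1/2 - 0) ^ j > 2"
    using I by (simp add: recovery_threshold_def \<kappa>_def j_def power_one_over field_simps)
  ultimately have "eventually (\<lambda>\<delta>. 2 < 2 * \<kappa> * (1/2 - \<delta>) ^ j) (at_right 0)"
    by (rule order_tendstoD)
  moreover have "eventually (\<lambda>\<delta>::real. \<delta> \<in> {0<..<1/4}) (at_right 0)"
    by (intro eventually_at_right_real) auto
  ultimately have "eventually (\<lambda>\<delta>. 2 < 2 * \<kappa> * (1/2 - \<delta>) ^ j \<and> \<delta> \<in> {0<..<1/4}) (at_right 0)"
    by (rule eventually_conj)
  from eventually_happens'[OF trivial_limit_at_right_real this]
  obtain \<delta> where \<delta>: "2 < 2 * \<kappa> * (1/2 - \<delta>) ^ j" "0 < \<delta>" "\<delta> < 1/4" by auto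
  define c where "c = 2 * \<kappa> * (1/2 - \<delta>) ^ j"
  have \<kappa>: "\<kappa> > 0"
    using \<delta>(1) unfolding \<kappa>_def by (cases "sqrt \<alpha> = sqrt \<beta>") auto
  define x y where "x = (\<lambda>n. real n powr (2 - c))"
    and "y = (\<lambda>n. 4 powr (1 / \<delta>) * real n powr (- (2 * \<kappa> / 8 ^ j)))"
  have "c > 2" using \<delta> by (simp add: c_def)
  then have x: "(x \<longlongrightarrow> 0) sequentially" 
    unfolding x_def by (intro tendsto_neg_powr filterlim_real_sequentially) auto
  have "2 * \<kappa> / 8 ^ j > 0" using \<kappa> by simp
  then have "((\<lambda>n. real n powr (- (2 * \<kappa> / 8 ^ j))) \<longlongrightarrow> 0) sequentially"
    by (intro tendsto_neg_powr filterlim_real_sequentially) auto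
  from tendsto_mult[OF tendsto_const[of "4 powr (1 / \<delta>)"] this]
  have y: "(y \<longlongrightarrow> 0) sequentially" by (simp add: y_def)
  let ?err = "\<lambda>n. error_prob n (p n) (q n) k (mle n (p n) (q n) k)"
  have "eventually (\<lambda>n. even n \<longrightarrow> ?err n \<le> 2 * x n + 2 * y n) sequentially"
  proof -
    have "eventually (\<lambda>n. x n < 1/2) sequentially" "eventually (\<lambda>n. y n < 1/2) sequentially"
      by (rule order_tendstoD(2)[OF x] order_tendstoD(2)[OF y]; simp)+
    moreover have "eventually (\<lambda>n. 8 * real j \<le> real n) sequentially"
      "eventually (\<lambda>n. 2 * real j / \<delta> \<le> real n) sequentially"
      by (rule eventually_compose_filterlim[OF eventually_ge_at_top filterlim_real_sequentially])+
    ultimately show ?thesis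
      using edge_prob_small[OF assms(1,2) zero_less_one] edge_prob_small[OF assms(1,3) zero_less_one] 
        eventually_gt_at_top[of 0]
    proof eventually_elim
      case (elim n)
      show ?case
      proof
        assume "even n"
        then obtain m where n: "n = 2 * m" by (elim evenE)
        let ?w = "ln (real n) / real ((n - 1) choose j)"
        have pq: "p n = \<alpha> * ?w" "q n = \<beta> * ?w" using p[OF \<open>even n\<close>] q[OF \<open>even n\<close>] elim by (simp_all add: j_def)
        have w: "?w \<ge> 0" using elim by auto
        have "?err n \<le> (\<Sum>t\<in>{1..m div 2}. (real (m choose t))\<^sup>2 *
           exp (- (2 * t * ((m - t) choose j) * (sqrt (p n) - sqrt (q n))\<^sup>2)))"
        proof -
          have "p n \<in> {0..1}" "q n \<in> {0..1}" unfolding pq j_def using elim by simp_all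
          from error_prob_mle_le[OF assms(1) this, of m] show ?thesis unfolding n j_def .
        qed
        also have "(sqrt (p n) - sqrt (q n))\<^sup>2 = \<kappa> * ?w"
          unfolding pq \<kappa>_def using assms w by (intro sqrt_diff_scaled) auto
        also have "(\<Sum>t\<in>{1..m div 2}. (real (m choose t))\<^sup>2 * exp (- (2 * t * ((m - t) choose j) * (\<kappa> * ?w))))
          \<le> 2 * x n + 2 * y n"
          unfolding n x_def y_def j_def
        proof (rule mle_union_bound_le)
          show "2 * real (k - 1) \<le> \<delta> * real (2 * m)"
            using elim \<delta> unfolding n j_def by (simp add: field_simps)
          show "8 * real (k - 1) \<le> real (2 * m)" using elim(3) by (simp only: n j_def)
          show "real (2 * m) powr (2 - c) \<le> 1 / 2" using elim(1) by (simp add: x_def n)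
          show "4 powr (1 / \<delta>) * real (2 * m) powr - (2 * \<kappa> / 8 ^ (k - 1)) \<le> 1 / 2"
            using elim(2) by (simp add: y_def n j_def)
          show "c \<le> 2 * \<kappa> * (1 / 2 - \<delta>) ^ (k - 1)" by (simp add: c_def j_def)
          show "m > 0" using elim n by simp
        qed (use \<delta> \<kappa> assms(1) in simp_all)
        finally show "?err n \<le> 2 * x n + 2 * y n" .
      qed
    qed
  qed
  then have "eventually (\<lambda>n. ?err n \<le> 2 * x n + 2 * y n) even_sequentially"
    unfolding even_sequentially_def by (simp add: eventually_inf_principal)
  moreover have "((\<lambda>n. 2 * x n + 2 * y n) \<longlongrightarrow> 0) even_sequentially"
    using tendsto_even_sequentiallyI[OF tendsto_add[OF tendsto_mult[OF tendsto_const[of 2] x] tendsto_mult[OF tendsto_const[of 2] y]]]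
    by simp
  moreover have "eventually (\<lambda>n. 0 \<le> ?err n) even_sequentially" by (simp add: error_prob_def)
  ultimately have "(?err \<longlongrightarrow> 0) even_sequentially"
    using tendsto_sandwich[of "\<lambda>_. 0" ?err even_sequentially "\<lambda>n. 2 * x n + 2 * y n" 0] by simp
  moreover have "is_estimator k (\<lambda>n. mle n (p n) (q n) k)"
    by (simp add: is_estimator_def mle_sign_vectors)
  ultimately show ?thesis unfolding exact_recovery_possible_def by blast
qed

subsection \<open>Posterior mass and the second moment\<close>

text \<open>A vector whose likelihood is matched by \<open>M\<close> competitors carries at most a fraction
  \<open>1 / M\<close> of the total likelihood, and any estimate is correct for only two vectors.\<close>

lemma error_prob_ge:
  fixes M :: nat and \<epsilon> :: real and est :: "nat set set \<Rightarrow> nat \<Rightarrow> int"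
  assumes "M > 0"
    and few: "\<And>\<sigma>. \<sigma> \<in> balanced_sign_vectors (2 * m) \<Longrightarrow>
      measure_pmf.prob (random_hypergraph (2 * m) p q k \<sigma>)
        {H. card {\<tau>\<in>balanced_sign_vectors (2 * m).
             pmf (random_hypergraph (2 * m) p q k \<sigma>) H \<le> pmf (random_hypergraph (2 * m) p q k \<tau>) H} < M} \<le> \<epsilon>"
  shows "error_prob (2 * m) p q k est \<ge> 1 - \<epsilon> - 2 / M"
proof -
  let ?B = "balanced_sign_vectors (2 * m)" and ?R = "random_hypergraph (2 * m) p q k"
  let ?E = "nsets {1..2*m} k"
  let ?L = "\<lambda>\<sigma> H. pmf (?R \<sigma>) H"
  define C where "C = (\<lambda>\<sigma>. {H. est H \<in> {\<sigma>, (\<lambda>v. - \<sigma> v)}})"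
  define F where "F = (\<lambda>\<sigma>. {H. card {\<tau>\<in>?B. ?L \<sigma> H \<le> ?L \<tau> H} < M})"
  have supp: "set_pmf (?R \<sigma>) \<subseteq> Pow ?E" for \<sigma>
    unfolding random_hypergraph_eq by (rule set_pmf_random_subset)
  have fin: "finite (Pow ?E)" by simp
  \<comment> \<open>Success is split: with few competitors it is charged to \<epsilon>, with many it
    is left to the count over hypergraphs.\<close>
  have C_le: "measure_pmf.prob (?R \<sigma>) (C \<sigma>) \<le> \<epsilon> + (\<Sum>H\<in>Pow ?E. if H \<in> C \<sigma> - F \<sigma> then ?L \<sigma> H else 0)"
    if "\<sigma> \<in> ?B" for \<sigma>
  proof -
    have "measure_pmf.prob (?R \<sigma>) (C \<sigma>) \<le> measure_pmf.prob (?R \<sigma>) (F \<sigma> \<union> (C \<sigma> - F \<sigma>))"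
      by (intro measure_pmf.finite_measure_mono) auto
    also have "\<dots> \<le> measure_pmf.prob (?R \<sigma>) (F \<sigma>) + measure_pmf.prob (?R \<sigma>) (C \<sigma> - F \<sigma>)"
      by (intro measure_Un_le) auto
    also have "measure_pmf.prob (?R \<sigma>) (F \<sigma>) \<le> \<epsilon>" using few[OF that] by (simp add: F_def)
    also have "measure_pmf.prob (?R \<sigma>) (C \<sigma> - F \<sigma>) = measure_pmf.prob (?R \<sigma>) (Pow ?E \<inter> (C \<sigma> - F \<sigma>))"
      using supp[of \<sigma>] by (intro measure_eq_AE) (auto simp: AE_measure_pmf_iff)
    also have "\<dots> = (\<Sum>H\<in>Pow ?E \<inter> (C \<sigma> - F \<sigma>). ?L \<sigma> H)"
      using fin by (intro measure_measure_pmf_finite finite_Int) auto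
    also have "\<dots> = (\<Sum>H\<in>Pow ?E. if H \<in> C \<sigma> - F \<sigma> then ?L \<sigma> H else 0)"
      using fin by (rule sum.inter_restrict)
    finally show ?thesis by simp
  qed
  \<comment> \<open>For a fixed hypergraph at most two vectors make the estimate correct, and each
    of them has at most a fraction \<open>1 / M\<close> of the total likelihood.\<close>
  have per_graph: "(\<Sum>\<sigma>\<in>?B. if H \<in> C \<sigma> - F \<sigma> then ?L \<sigma> H else 0) \<le> 2 / M * (\<Sum>\<tau>\<in>?B. ?L \<tau> H)" for H
  proof -
    let ?S = "{\<sigma>\<in>?B. H \<in> C \<sigma> - F \<sigma>}"
    have bound: "?L \<sigma> H \<le> (\<Sum>\<tau>\<in>?B. ?L \<tau> H) / M" if "\<sigma> \<in> ?S" for \<sigma>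
    proof -
      let ?T = "{\<tau>\<in>?B. ?L \<sigma> H \<le> ?L \<tau> H}"
      have "card ?T \<ge> M" using that by (simp add: F_def)
      then have "real M * ?L \<sigma> H \<le> real (card ?T) * ?L \<sigma> H" by (intro mult_right_mono) auto
      also have "\<dots> = (\<Sum>\<tau>\<in>?T. ?L \<sigma> H)" by simp
      also have "\<dots> \<le> (\<Sum>\<tau>\<in>?T. ?L \<tau> H)" by (intro sum_mono) auto
      also have "\<dots> \<le> (\<Sum>\<tau>\<in>?B. ?L \<tau> H)" by (intro sum_mono2) auto
      finally show ?thesis using \<open>M > 0\<close> by (simp add: field_simps)
    qed
    have "?S \<subseteq> {est H, (\<lambda>v. - est H v)}"
    proof
      fix \<sigma> assume "\<sigma> \<in> ?S"
      then have "est H = \<sigma> \<or> est H = (\<lambda>v. - \<sigma> v)" by (auto simp: C_def)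
      then show "\<sigma> \<in> {est H, (\<lambda>v. - est H v)}" by auto
    qed
    then have "card ?S \<le> card {est H, (\<lambda>v. - est H v)}" by (intro card_mono) auto
    also have "\<dots> \<le> 2" by (simp add: card_insert_if)
    finally have S2: "card ?S \<le> 2" .
    have "(\<Sum>\<sigma>\<in>?B. if H \<in> C \<sigma> - F \<sigma> then ?L \<sigma> H else 0) = (\<Sum>\<sigma>\<in>?S. ?L \<sigma> H)"
      by (rule sum.inter_filter[symmetric]) simp
    also have "\<dots> \<le> (\<Sum>\<sigma>\<in>?S. (\<Sum>\<tau>\<in>?B. ?L \<tau> H) / M)" by (intro sum_mono bound)
    also have "\<dots> = real (card ?S) * ((\<Sum>\<tau>\<in>?B. ?L \<tau> H) / M)" by simp
    also have "\<dots> \<le> 2 * ((\<Sum>\<tau>\<in>?B. ?L \<tau> H) / M)"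
      using S2 by (intro mult_right_mono divide_nonneg_nonneg sum_nonneg) auto
    finally show ?thesis by simp
  qed
  have tot: "(\<Sum>H\<in>Pow ?E. ?L \<tau> H) = 1" for \<tau>
    using fin supp by (rule sum_pmf_eq_1)
  have "(\<Sum>\<sigma>\<in>?B. measure_pmf.prob (?R \<sigma>) (C \<sigma>))
      \<le> (\<Sum>\<sigma>\<in>?B. \<epsilon> + (\<Sum>H\<in>Pow ?E. if H \<in> C \<sigma> - F \<sigma> then ?L \<sigma> H else 0))"
    by (intro sum_mono C_le)
  \<comment> \<open>Exchanging the sums fixes the hypergraph and varies the vector, which is the
    viewpoint of the posterior distribution.\<close>
  also have "\<dots> = card ?B * \<epsilon> + (\<Sum>H\<in>Pow ?E. \<Sum>\<sigma>\<in>?B. if H \<in> C \<sigma> - F \<sigma> then ?L \<sigma> H else 0)"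
    by (simp only: sum.distrib sum_constant sum.swap[of _ "?B"])
  also have "\<dots> \<le> card ?B * \<epsilon> + (\<Sum>H\<in>Pow ?E. 2 / M * (\<Sum>\<tau>\<in>?B. ?L \<tau> H))"
    by (intro add_left_mono sum_mono per_graph)
  also have "(\<Sum>H\<in>Pow ?E. 2 / M * (\<Sum>\<tau>\<in>?B. ?L \<tau> H)) = 2 / M * (\<Sum>\<tau>\<in>?B. \<Sum>H\<in>Pow ?E. ?L \<tau> H)"
    by (simp only: sum_distrib_left[symmetric] sum.swap[of _ "Pow ?E"])
  also have "\<dots> = card ?B * (2 / M)" unfolding tot by simp
  finally have succ: "(\<Sum>\<sigma>\<in>?B. measure_pmf.prob (?R \<sigma>) (C \<sigma>)) \<le> card ?B * (\<epsilon> + 2 / M)"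
    by (simp only: distrib_left)
  have compl: "measure_pmf.prob (?R \<sigma>) {H. est H \<notin> {\<sigma>, (\<lambda>v. - \<sigma> v)}} = 1 - measure_pmf.prob (?R \<sigma>) (C \<sigma>)" for \<sigma>
  proof -
    have "{H. est H \<notin> {\<sigma>, (\<lambda>v. - \<sigma> v)}} = space (measure_pmf (?R \<sigma>)) - C \<sigma>" by (auto simp: C_def)
    then show ?thesis by (simp only: measure_pmf.prob_compl[of "C \<sigma>"] sets_measure_pmf UNIV_I)
  qed
  have "error_prob (2 * m) p q k est = (card ?B - (\<Sum>\<sigma>\<in>?B. measure_pmf.prob (?R \<sigma>) (C \<sigma>))) / card ?B"
    unfolding error_prob_eq compl by (simp add: sum_subtractf)
  also have "\<dots> \<ge> (card ?B - card ?B * (\<epsilon> + 2 / M)) / card ?B"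
    using succ by (intro divide_right_mono) auto
  also have "(card ?B - card ?B * (\<epsilon> + 2 / M)) / card ?B = 1 - \<epsilon> - 2 / M"
    by (simp add: diff_divide_distrib balanced_nonempty)
  finally show ?thesis .
qed

text \<open>Chebyshev's argument around \<open>a\<close> instead of the true mean of the count,
  which is only known to lie between \<open>a * (1 - \<eta>)\<close> and \<open>a\<close>. The
  second moment about \<open>a\<close> is at most \<open>a + 2 * \<eta> * a\<^sup>2\<close>, and a
  count below \<open>a / 2\<close> deviates by at least \<open>a / 2\<close>.\<close>

lemma prob_few_events_le:
  fixes P :: "'b pmf" and G :: "'a \<Rightarrow> 'b \<Rightarrow> bool" and b \<eta> :: real
  assumes fin: "finite U" and "b > 0"
    and lo: "\<And>u. u \<in> U \<Longrightarrow> b * (1 - \<eta>) \<le> measure_pmf.prob P {x. G u x}"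
    and hi: "\<And>u. u \<in> U \<Longrightarrow> measure_pmf.prob P {x. G u x} \<le> b"
    and pair: "\<And>u v. u \<in> U \<Longrightarrow> v \<in> U \<Longrightarrow> u \<noteq> v \<Longrightarrow> measure_pmf.prob P {x. G u x \<and> G v x} \<le> b\<^sup>2"
  defines "a \<equiv> real (card U) * b"
  assumes "a > 0" and M: "real M \<le> a / 2"
  shows "measure_pmf.prob P {x. card {u\<in>U. G u x} < M} \<le> 4 / a + 8 * \<eta>"
proof -
  let ?I = "\<lambda>u x. indicator {x. G u x} x :: real"
  let ?N = "\<lambda>x. \<Sum>u\<in>U. ?I u x"
  have N: "?N x = real (card {u\<in>U. G u x})" for x
    using fin by (simp add: indicator_def sum.If_cases Int_def)
  have sq: "(?N x - a)\<^sup>2 = (\<Sum>u\<in>U. \<Sum>v\<in>U. indicator {x. G u x \<and> G v x} x) - 2 * a * ?N x + a\<^sup>2" for x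
  proof -
    have "?N x * ?N x = (\<Sum>u\<in>U. \<Sum>v\<in>U. ?I u x * ?I v x)" by (rule sum_product)
    also have "\<dots> = (\<Sum>u\<in>U. \<Sum>v\<in>U. indicator {x. G u x \<and> G v x} x)"
      by (intro sum.cong refl) (auto simp: indicator_def)
    finally show ?thesis by (simp add: power2_eq_square algebra_simps)
  qed
  have int [simp]: "integrable (measure_pmf P) (\<lambda>x. indicator A x :: real)" for A
    by (intro measure_pmf.integrable_const_bound[where B = 1]) auto
  have isq: "integrable (measure_pmf P) (\<lambda>x. (?N x - a)\<^sup>2)"
    unfolding sq by simp
  have EN: "measure_pmf.expectation P ?N = (\<Sum>u\<in>U. measure_pmf.prob P {x. G u x})" by simp
  have "measure_pmf.expectation P (\<lambda>x. (?N x - a)\<^sup>2) =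
      (\<Sum>u\<in>U. \<Sum>v\<in>U. measure_pmf.prob P {x. G u x \<and> G v x}) - 2 * a * measure_pmf.expectation P ?N + a\<^sup>2"
    unfolding sq by simp
  \<comment> \<open>Adding \<open>b\<^sup>2\<close> on the diagonal as well makes the double sum
    exactly \<open>a + a\<^sup>2\<close>.\<close>
  also have "\<dots> \<le> (\<Sum>u\<in>U. \<Sum>v\<in>U. (if u = v then b else 0) + b\<^sup>2) - 2 * a * (a * (1 - \<eta>)) + a\<^sup>2"
  proof (intro add_right_mono diff_mono mult_left_mono sum_mono)
    fix u v assume "u \<in> U" "v \<in> U"
    then show "measure_pmf.prob P {x. G u x \<and> G v x} \<le> (if u = v then b else 0) + b\<^sup>2"
      using pair[of u v] hi[of u] by (cases "u = v") (auto intro: add_increasing2)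
  next
    have "a * (1 - \<eta>) = (\<Sum>u\<in>U. b * (1 - \<eta>))" by (simp add: a_def)
    also have "\<dots> \<le> measure_pmf.expectation P ?N" unfolding EN by (intro sum_mono lo)
    finally show "a * (1 - \<eta>) \<le> measure_pmf.expectation P ?N" .
  qed (use \<open>a > 0\<close> in auto)
  also have "\<dots> = a + 2 * \<eta> * a\<^sup>2"
    using fin by (simp add: sum.distrib a_def power2_eq_square algebra_simps)
  finally have E: "measure_pmf.expectation P (\<lambda>x. (?N x - a)\<^sup>2) \<le> a + 2 * \<eta> * a\<^sup>2" .
  have "measure_pmf.prob P {x. card {u\<in>U. G u x} < M} \<le> measure_pmf.prob P {x. a\<^sup>2 / 4 \<le> (?N x - a)\<^sup>2}"
  proof (intro measure_pmf.finite_measure_mono subsetI CollectI)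
    fix x assume "x \<in> {x. card {u\<in>U. G u x} < M}"
    then have "a / 2 \<le> a - ?N x" unfolding N using M by auto
    then have "(a / 2)\<^sup>2 \<le> (a - ?N x)\<^sup>2" using \<open>a > 0\<close> by (intro power_mono) auto
    then show "a\<^sup>2 / 4 \<le> (?N x - a)\<^sup>2" by (simp add: power2_commute[of a] power_divide)
  qed auto
  also have "\<dots> \<le> measure_pmf.expectation P (\<lambda>x. (?N x - a)\<^sup>2) / (a\<^sup>2 / 4)"
    using integral_Markov_inequality_measure[OF isq, where A = UNIV and c = "a\<^sup>2 / 4"] \<open>a > 0\<close> by simp
  also have "\<dots> \<le> (a + 2 * \<eta> * a\<^sup>2) / (a\<^sup>2 / 4)"
    using E \<open>a > 0\<close> by (intro divide_right_mono) auto
  also have "\<dots> = 4 / a + 8 * \<eta>" using \<open>a > 0\<close> by (simp add: field_simps power2_eq_square)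
  finally show ?thesis .
qed

subsection \<open>Tied vertices\<close>

text \<open>\<open>R\<close> is the set of selected vertices. Demanding
  \<open>e \<inter> R = {u}\<close> makes the families of different vertices disjoint, hence
  independent. At \<open>flip \<sigma> u\<close> the definition yields the edges that become uniform
  when \<open>u\<close> changes sides.\<close>

definition private_edges :: "nat \<Rightarrow> nat \<Rightarrow> nat set \<Rightarrow> (nat \<Rightarrow> int) \<Rightarrow> nat \<Rightarrow> nat set set" where
  "private_edges n k R \<sigma> u = {e\<in>nsets {1..n} k. e \<inter> R = {u} \<and> same_community \<sigma> e}"

text \<open>For \<open>u\<close> in \<open>R\<close> these are the edges at \<open>u\<close> shared
  with another selected vertex, exactly those that private edges ignore.\<close>

definition crossing_edges :: "nat \<Rightarrow> nat \<Rightarrow> nat set \<Rightarrow> nat \<Rightarrow> nat set set" where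
  "crossing_edges n k R u = {e\<in>nsets {1..n} k. u \<in> e \<and> e \<inter> R \<noteq> {u}}"

definition flip :: "(nat \<Rightarrow> int) \<Rightarrow> nat \<Rightarrow> nat \<Rightarrow> int" where
  "flip \<sigma> u = \<sigma>(u := - \<sigma> u)"

definition tied :: "nat \<Rightarrow> nat \<Rightarrow> nat set \<Rightarrow> (nat \<Rightarrow> int) \<Rightarrow> nat \<Rightarrow> nat set set \<Rightarrow> bool" where
  "tied n k R \<sigma> u H \<longleftrightarrow>
    card (H \<inter> private_edges n k R \<sigma> u) = card (H \<inter> private_edges n k R (flip \<sigma> u) u)"

text \<open>When no crossing edge is present, the private counts are the full counts at
  \<open>u\<close>, so the tie is one of the actual likelihood.\<close>

definition isolated_tied :: "nat \<Rightarrow> nat \<Rightarrow> nat set \<Rightarrow> (nat \<Rightarrow> int) \<Rightarrow> nat \<Rightarrow> nat set set \<Rightarrow> bool" where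
  "isolated_tied n k R \<sigma> u H \<longleftrightarrow> tied n k R \<sigma> u H \<and> H \<inter> crossing_edges n k R u = {}"

text \<open>The likelihood is a monomial in \<open>p\<close>, \<open>q\<close>, \<open>1 - p\<close>
  and \<open>1 - q\<close>, and its exponents depend on the sign vector only through these two
  counts.\<close>

lemma pmf_random_hypergraph_cong:
  assumes pq: "p \<in> {0..1}" "q \<in> {0..1}" and H: "H \<subseteq> nsets {1..n} k"
    and cH: "card {e\<in>H. same_community \<sigma> e} = card {e\<in>H. same_community \<tau> e}"
    and cE: "card {e\<in>nsets {1..n} k. same_community \<sigma> e} = card {e\<in>nsets {1..n} k. same_community \<tau> e}"
  shows "pmf (random_hypergraph n p q k \<sigma>) H = pmf (random_hypergraph n p q k \<tau>) H"
proof -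
  let ?E = "nsets {1..n} k"
  have finE: "finite ?E" by simp
  have finH: "finite H" using H finE by (rule finite_subset)
  have *: "pmf (random_hypergraph n p q k \<rho>) H =
     p ^ card {e\<in>H. same_community \<rho> e} * q ^ (card H - card {e\<in>H. same_community \<rho> e}) *
     ((1 - p) ^ (card {e\<in>?E. same_community \<rho> e} - card {e\<in>H. same_community \<rho> e}) *
      (1 - q) ^ (card (?E - H) - (card {e\<in>?E. same_community \<rho> e} - card {e\<in>H. same_community \<rho> e})))" for \<rho>
  proof -
    let ?s = "same_community \<rho>"
    have "pmf (random_hypergraph n p q k \<rho>) H =
        (\<Prod>e\<in>?E. if e \<in> H then (if ?s e then p else q) else (if ?s e then 1 - p else 1 - q))"
      unfolding random_hypergraph_eq using pq H by (subst pmf_random_subset) (auto intro!: prod.cong)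
    also have "\<dots> = (\<Prod>e\<in>H. if ?s e then p else q) * (\<Prod>e\<in>?E - H. if ?s e then 1 - p else 1 - q)"
      using finE H by (subst prod.If_cases) (auto simp: Int_absorb1 Diff_eq)
    also have "(\<Prod>e\<in>H. if ?s e then p else q) = p ^ card {e\<in>H. ?s e} * q ^ card (H - {e\<in>H. ?s e})"
    proof -
      have "H \<inter> {e. ?s e} = {e\<in>H. ?s e}" "H \<inter> - {e. ?s e} = H - {e\<in>H. ?s e}" by auto
      then show ?thesis using finH by (simp add: prod.If_cases)
    qed
    also have "(\<Prod>e\<in>?E - H. if ?s e then 1 - p else 1 - q) =
        (1 - p) ^ card ({e\<in>?E. ?s e} - {e\<in>H. ?s e}) * (1 - q) ^ card ((?E - H) - ({e\<in>?E. ?s e} - {e\<in>H. ?s e}))"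
    proof -
      have "(?E - H) \<inter> {e. ?s e} = {e\<in>?E. ?s e} - {e\<in>H. ?s e}"
        "(?E - H) \<inter> - {e. ?s e} = (?E - H) - ({e\<in>?E. ?s e} - {e\<in>H. ?s e})" by auto
      then show ?thesis using finE by (simp add: prod.If_cases)
    qed
    also have "card (H - {e\<in>H. ?s e}) = card H - card {e\<in>H. ?s e}"
      using finH by (intro card_Diff_subset) auto
    also have "card ((?E - H) - ({e\<in>?E. ?s e} - {e\<in>H. ?s e})) = card (?E - H) - card ({e\<in>?E. ?s e} - {e\<in>H. ?s e})"
      using finE by (intro card_Diff_subset) auto
    also have "card ({e\<in>?E. ?s e} - {e\<in>H. ?s e}) = card {e\<in>?E. ?s e} - card {e\<in>H. ?s e}"
      using finH H by (intro card_Diff_subset) auto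
    finally show ?thesis .
  qed
  show ?thesis unfolding * cH cE ..
qed

text \<open>The value is the same for all balanced vectors, so between them only the count inside
  \<open>H\<close> can change the likelihood.\<close>

lemma card_same_community:
  assumes "\<sigma> \<in> balanced_sign_vectors (2 * m)" "k > 0"
  shows "card {e\<in>nsets {1..2*m} k. same_community \<sigma> e} = 2 * (m choose k)"
proof -
  let ?P = "positives (2*m) \<sigma>" and ?N = "negatives (2*m) \<sigma>"
  have "{e\<in>nsets {1..2*m} k. same_community \<sigma> e} = nsets ?P k \<union> nsets ?N k"
  proof (intro equalityI subsetI)
    fix e assume e: "e \<in> {e\<in>nsets {1..2*m} k. same_community \<sigma> e}"
    then have e': "e \<subseteq> {1..2*m}" "finite e" "card e = k" by (simp_all add: nsets_def)
    have same: "\<sigma> u = \<sigma> v" if "u \<in> e" "v \<in> e" for u v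
      using e that unfolding same_community_def by blast
    have cover: "e \<subseteq> ?P \<union> ?N" using e'(1) assms positives_Un[of \<sigma> "2*m"] by (simp add: balanced_iff)
    have "e \<subseteq> ?P \<or> e \<subseteq> ?N"
    proof (rule ccontr)
      assume "\<not> (e \<subseteq> ?P \<or> e \<subseteq> ?N)"
      then obtain u v where "u \<in> e" "u \<in> ?N" "v \<in> e" "v \<in> ?P" using cover by blast
      then show False using same[of u v] by (simp add: positives_def negatives_def)
    qed
    then show "e \<in> nsets ?P k \<union> nsets ?N k" using e' by (auto simp: nsets_def)
  next
    fix e assume "e \<in> nsets ?P k \<union> nsets ?N k"
    then have "finite e" "card e = k" "e \<subseteq> ?P \<or> e \<subseteq> ?N" by (auto simp: nsets_def)
    moreover have "same_community \<sigma> e" if "e \<subseteq> ?P \<or> e \<subseteq> ?N"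
    proof -
      have "\<exists>c. \<forall>u\<in>e. \<sigma> u = c" using that by (auto simp: positives_def negatives_def)
      then show ?thesis unfolding same_community_def by metis
    qed
    ultimately show "e \<in> {e\<in>nsets {1..2*m} k. same_community \<sigma> e}"
      using positives_subset[of "2*m" \<sigma>] unfolding nsets_def by blast
  qed
  then have "card {e\<in>nsets {1..2*m} k. same_community \<sigma> e} = card (nsets ?P k \<union> nsets ?N k)"
    by (rule arg_cong)
  also have "\<dots> = card (nsets ?P k) + card (nsets ?N k)"
  proof (intro card_Un_disjoint finite_imp_finite_nsets finite_positives)
    have "e = {}" if "e \<in> nsets ?P k" "e \<in> nsets ?N k" for e
      using that positives_disjoint[of "2*m" \<sigma>] unfolding nsets_def by blast
    \<comment> \<open>A positive \<open>k\<close> excludes the empty edge, the only set that could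
      lie in both communities.\<close>
    moreover have "{} \<notin> nsets ?P k" using assms(2) by (simp add: nsets_def)
    ultimately show "nsets ?P k \<inter> nsets ?N k = {}" by blast
  qed
  also have "\<dots> = 2 * (m choose k)" using assms(1) by (simp add: card_nsets balanced_iff)
  finally show ?thesis .
qed

lemma swap_balanced:
  assumes "\<sigma> \<in> balanced_sign_vectors (2 * m)" "u \<in> positives (2 * m) \<sigma>" "w \<in> negatives (2 * m) \<sigma>"
  shows "flip (flip \<sigma> u) w \<in> balanced_sign_vectors (2 * m)"
proof -
  let ?\<tau> = "flip (flip \<sigma> u) w"
  have uw: "u \<noteq> w" "\<sigma> u = 1" "\<sigma> w = -1" "u \<in> {1..2*m}" "w \<in> {1..2*m}"
    using assms by (auto simp: positives_def negatives_def)
  have P: "positives (2*m) ?\<tau> = insert w (positives (2*m) \<sigma> - {u})"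
    and N: "negatives (2*m) ?\<tau> = insert u (negatives (2*m) \<sigma> - {w})"
    using uw by (auto simp: positives_def negatives_def flip_def)
  have "w \<notin> positives (2*m) \<sigma>" "u \<notin> negatives (2*m) \<sigma>"
    using uw by (auto simp: positives_def negatives_def)
  then have "card (positives (2*m) ?\<tau>) = card (positives (2*m) \<sigma>)" "card (negatives (2*m) ?\<tau>) = card (negatives (2*m) \<sigma>)"
    unfolding P N using card.remove[OF _ assms(2)] card.remove[OF _ assms(3)] by simp_all
  moreover have "?\<tau> \<in> sign_vectors (2*m)"
    using assms(1) uw by (auto simp: balanced_iff sign_vectors_iff flip_def)
  ultimately show ?thesis using assms(1) by (simp add: balanced_iff)
qed

text \<open>Since no edge of \<open>H\<close> contains both \<open>u\<close> and \<open>w\<close>,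
  its uniform edges split into those avoiding both, which the swap does not affect, those at
  \<open>u\<close> and those at \<open>w\<close>. On the latter two the swap acts like a single
  flip, and the ties preserve their numbers.\<close>

lemma swap_likelihood:
  assumes \<sigma>: "\<sigma> \<in> balanced_sign_vectors (2 * m)" and "k > 0" "p \<in> {0..1}" "q \<in> {0..1}"
    and H: "H \<subseteq> nsets {1..2*m} k"
    and u: "u \<in> positives (2 * m) \<sigma> \<inter> R" "isolated_tied (2 * m) k R \<sigma> u H"
    and w: "w \<in> negatives (2 * m) \<sigma> \<inter> R" "isolated_tied (2 * m) k R \<sigma> w H"
  shows "pmf (random_hypergraph (2 * m) p q k (flip (flip \<sigma> u) w)) H = pmf (random_hypergraph (2 * m) p q k \<sigma>) H"
proof -
  let ?\<tau> = "flip (flip \<sigma> u) w" and ?I = "private_edges (2*m) k R"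
  have uw: "u \<noteq> w" using u w by (auto simp: positives_def negatives_def)
  have finH: "finite H" using H by (rule finite_subset) simp
  have eu: "e \<inter> R = {u}" if "e \<in> H" "u \<in> e" for e
    using u(2) H that by (auto simp: isolated_tied_def crossing_edges_def)
  have ew: "e \<inter> R = {w}" if "e \<in> H" "w \<in> e" for e
    using w(2) H that by (auto simp: isolated_tied_def crossing_edges_def)
  have cong: "same_community \<rho> e = same_community \<rho>' e" if "\<And>v. v \<in> e \<Longrightarrow> \<rho> v = \<rho>' v" for \<rho> \<rho>' :: "nat \<Rightarrow> int" and e
    using that by (simp add: same_community_def)
  have split: "card {e\<in>H. same_community \<rho> e} = card {e\<in>H. e \<inter> {u, w} = {} \<and> same_community \<rho> e}
      + card {e\<in>H. u \<in> e \<and> same_community \<rho> e} + card {e\<in>H. w \<in> e \<and> same_community \<rho> e}" for \<rho> :: "nat \<Rightarrow> int"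
  proof -
    let ?A = "{e\<in>H. e \<inter> {u, w} = {} \<and> same_community \<rho> e}"
    let ?U = "{e\<in>H. u \<in> e \<and> same_community \<rho> e}" and ?W = "{e\<in>H. w \<in> e \<and> same_community \<rho> e}"
    have "u \<notin> e \<or> w \<notin> e" if "e \<in> H" for e using eu[OF that] w(1) uw by fastforce
    then have "?A \<inter> ?U = {}" "(?A \<union> ?U) \<inter> ?W = {}" by blast+
    then have "card (?A \<union> ?U \<union> ?W) = card ?A + card ?U + card ?W"
      using finH by (simp add: card_Un_disjoint)
    moreover have "{e\<in>H. same_community \<rho> e} = ?A \<union> ?U \<union> ?W" by blast
    ultimately show ?thesis by simp
  qed
  have 0: "{e\<in>H. e \<inter> {u, w} = {} \<and> same_community ?\<tau> e} = {e\<in>H. e \<inter> {u, w} = {} \<and> same_community \<sigma> e}"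
  proof -
    have "same_community ?\<tau> e = same_community \<sigma> e" if "e \<inter> {u, w} = {}" for e
      using that by (intro cong) (auto simp: flip_def)
    then show ?thesis by blast
  qed
  have restrict: "{e\<in>H. v \<in> e \<and> same_community \<rho> e} = H \<inter> ?I \<rho>' v"
    if "\<And>e. e \<in> H \<Longrightarrow> v \<in> e \<Longrightarrow> e \<inter> R = {v} \<and> same_community \<rho> e = same_community \<rho>' e" for \<rho> \<rho>' v
  proof (intro equalityI subsetI)
    fix e assume "e \<in> {e\<in>H. v \<in> e \<and> same_community \<rho> e}"
    then show "e \<in> H \<inter> ?I \<rho>' v" using that[of e] H unfolding private_edges_def by blast
  next
    fix e assume "e \<in> H \<inter> ?I \<rho>' v"
    then have "e \<in> H" "e \<inter> R = {v}" "same_community \<rho>' e" by (simp_all add: private_edges_def)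
    then show "e \<in> {e\<in>H. v \<in> e \<and> same_community \<rho> e}" using that[of e] by blast
  qed
  have su: "{e\<in>H. u \<in> e \<and> same_community \<sigma> e} = H \<inter> ?I \<sigma> u"
    and sw: "{e\<in>H. w \<in> e \<and> same_community \<sigma> e} = H \<inter> ?I \<sigma> w"
    by (rule restrict; use eu ew in simp)+
  have tu: "{e\<in>H. u \<in> e \<and> same_community ?\<tau> e} = H \<inter> ?I (flip \<sigma> u) u"
  proof (rule restrict)
    fix e assume e: "e \<in> H" "u \<in> e"
    then have "w \<notin> e" using eu[OF e] w(1) uw by fastforce
    then have "same_community ?\<tau> e = same_community (flip \<sigma> u) e"
      by (intro cong) (auto simp: flip_def)
    then show "e \<inter> R = {u} \<and> same_community ?\<tau> e = same_community (flip \<sigma> u) e" using eu[OF e] by simp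
  qed
  have tw: "{e\<in>H. w \<in> e \<and> same_community ?\<tau> e} = H \<inter> ?I (flip \<sigma> w) w"
  proof (rule restrict)
    fix e assume e: "e \<in> H" "w \<in> e"
    then have "u \<notin> e" using ew[OF e] u(1) uw by fastforce
    then have "same_community ?\<tau> e = same_community (flip \<sigma> w) e"
      by (intro cong) (auto simp: flip_def)
    then show "e \<inter> R = {w} \<and> same_community ?\<tau> e = same_community (flip \<sigma> w) e" using ew[OF e] by simp
  qed
  have "card {e\<in>H. same_community ?\<tau> e} = card {e\<in>H. same_community \<sigma> e}"
    using u(2) w(2) unfolding split 0 tu tw su sw by (simp add: isolated_tied_def tied_def)
  moreover have "card {e\<in>nsets {1..2*m} k. same_community ?\<tau> e} = card {e\<in>nsets {1..2*m} k. same_community \<sigma> e}"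
    using card_same_community[OF \<sigma>] card_same_community[OF swap_balanced[OF \<sigma>]] u(1) w(1) \<open>k > 0\<close> by simp
  ultimately show ?thesis by (intro pmf_random_hypergraph_cong assms) 
qed

section \<open>Counting private and crossing edges, and the probability of ties\<close>

lemma private_edges_star:
  assumes "u \<in> R" "u \<in> {1..n}" "k > 0"
  shows "private_edges n k R \<sigma> u = star_edges k {u} {v\<in>{1..n} - R. \<sigma> v = \<sigma> u}"
proof (intro equalityI subsetI)
  let ?Y = "{v\<in>{1..n} - R. \<sigma> v = \<sigma> u}"
  fix e assume "e \<in> private_edges n k R \<sigma> u"
  then have e: "e \<subseteq> {1..n}" "finite e" "card e = k" "e \<inter> R = {u}" "same_community \<sigma> e"
    by (simp_all add: private_edges_def nsets_def)
  then have u: "u \<in> e" by blast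
  have "v \<in> ?Y" if "v \<in> e - {u}" for v
  proof -
    have "\<sigma> v = \<sigma> u" using e(5) u that unfolding same_community_def by blast
    moreover have "v \<notin> R" using e(4) that by fastforce
    ultimately show ?thesis using e(1) that by blast
  qed
  then have "e - {u} \<subseteq> ?Y" by blast
  then have "e - {u} \<in> nsets ?Y (k - 1)"
    using e(2,3) u by (simp add: nsets_def)
  moreover have "e = insert u (e - {u})" using u by blast
  ultimately show "e \<in> star_edges k {u} ?Y" unfolding star_edges_def by (intro image_eqI[of _ _ "(u, e - {u})"]) simp_all
next
  let ?Y = "{v\<in>{1..n} - R. \<sigma> v = \<sigma> u}"
  fix e assume e: "e \<in> star_edges k {u} ?Y"
  have "star_edges k {u} ?Y \<subseteq> nsets {1..n} k"
    using assms by (intro star_edges_nsets) auto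
  then have "e \<in> nsets {1..n} k" using e by blast
  moreover obtain S where S: "e = insert u S" "S \<subseteq> ?Y"
    using e by (auto simp: star_edges_def nsets_def)
  then have "e \<inter> R = {u}" using assms(1) by auto
  moreover have "\<forall>v\<in>e. \<sigma> v = \<sigma> u" using S by auto
  then have "same_community \<sigma> e" unfolding same_community_def by metis
  ultimately show "e \<in> private_edges n k R \<sigma> u" by (simp add: private_edges_def)
qed

text \<open>Selecting \<open>s\<close> vertices from each side leaves \<open>m - s\<close>
  unselected ones on both. So a tie compares binomial counts with the same number of trials.\<close>

lemma card_private_edges:
  assumes \<sigma>: "\<sigma> \<in> balanced_sign_vectors (2 * m)"
    and U: "U \<subseteq> positives (2 * m) \<sigma>" "card U = s" and W: "W \<subseteq> negatives (2 * m) \<sigma>" "card W = s"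
    and u: "u \<in> U \<union> W" and "k > 0"
  shows "card (private_edges (2 * m) k (U \<union> W) \<sigma> u) = (m - s) choose (k - 1)"
    "card (private_edges (2 * m) k (U \<union> W) (flip \<sigma> u) u) = (m - s) choose (k - 1)"
proof -
  have fin: "finite U" "finite W" using U W by (auto intro: finite_subset)
  have u': "u \<in> {1..2*m}" "\<sigma> u = 1 \<or> \<sigma> u = -1"
    using u U(1) W(1) by (auto simp: positives_def negatives_def)
  have "{v\<in>{1..2*m} - (U \<union> W). \<sigma> v = 1} = positives (2*m) \<sigma> - U"
    "{v\<in>{1..2*m} - (U \<union> W). \<sigma> v = -1} = negatives (2*m) \<sigma> - W"
    using U(1) W(1) by (auto simp: positives_def negatives_def)
  then have "card {v\<in>{1..2*m} - (U \<union> W). \<sigma> v = 1} = m - s" "card {v\<in>{1..2*m} - (U \<union> W). \<sigma> v = -1} = m - s"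
    using U W \<sigma> fin by (simp_all add: card_Diff_subset balanced_iff)
  then have c: "card {v\<in>{1..2*m} - (U \<union> W). \<sigma> v = \<sigma> u} = m - s" "card {v\<in>{1..2*m} - (U \<union> W). \<sigma> v = - \<sigma> u} = m - s"
    using u'(2) by auto
  show "card (private_edges (2 * m) k (U \<union> W) \<sigma> u) = (m - s) choose (k - 1)"
    unfolding private_edges_star[OF u u'(1) \<open>k > 0\<close>] using u by (subst card_star_edges) (auto simp: c(1)[simplified])
  have "{v\<in>{1..2*m} - (U \<union> W). flip \<sigma> u v = flip \<sigma> u u} = {v\<in>{1..2*m} - (U \<union> W). \<sigma> v = - \<sigma> u}"
    using u by (auto simp: flip_def)
  with c(2) have c': "card {v\<in>{1..2*m} - (U \<union> W). flip \<sigma> u v = flip \<sigma> u u} = m - s" by simp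
  show "card (private_edges (2 * m) k (U \<union> W) (flip \<sigma> u) u) = (m - s) choose (k - 1)"
    unfolding private_edges_star[OF u u'(1) \<open>k > 0\<close>] using u by (subst card_star_edges) (auto simp: c'[simplified])
qed

lemma private_edges_disjoint:
  assumes "\<sigma> u \<noteq> 0" "k \<ge> 2"
  shows "private_edges n k R \<sigma> u \<inter> private_edges n k R (flip \<sigma> u) u = {}"
proof -
  have False if "e \<in> private_edges n k R \<sigma> u" "e \<in> private_edges n k R (flip \<sigma> u) u" for e
  proof -
    have e: "card e = k" "u \<in> e" "same_community \<sigma> e" "same_community (flip \<sigma> u) e"
      using that by (auto simp: private_edges_def nsets_def)
    have "\<not> e \<subseteq> {u}" using e(1) assms(2) card_mono[of "{u}" e] by auto
    then obtain v where v: "v \<in> e" "v \<noteq> u" by blast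
    have "\<sigma> v = \<sigma> u" "flip \<sigma> u v = flip \<sigma> u u" using e v unfolding same_community_def by blast+
    then show False using v assms(1) by (simp add: flip_def)
  qed
  then show ?thesis by blast
qed

lemma card_pair_edges:
  assumes "u \<in> {1..n}" "v \<in> {1..n}" "u \<noteq> v" "k \<ge> 2"
  shows "card {e\<in>nsets {1..n} k. u \<in> e \<and> v \<in> e} \<le> (n - 2) choose (k - 2)"
proof -
  let ?V = "{1..n} - {u, v}"
  have "{e\<in>nsets {1..n} k. u \<in> e \<and> v \<in> e} \<subseteq> (\<lambda>S. insert u (insert v S)) ` nsets ?V (k - 2)"
  proof
    fix e assume "e \<in> {e\<in>nsets {1..n} k. u \<in> e \<and> v \<in> e}"
    then have e: "e \<subseteq> {1..n}" "finite e" "card e = k" "u \<in> e" "v \<in> e" by (auto simp: nsets_def)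
    have "card (e - {u, v}) = k - 2" using e assms(3) by (simp add: card_Diff_subset)
    then have "e - {u, v} \<in> nsets ?V (k - 2)" using e(1,2) by (auto simp: nsets_def)
    moreover have "e = insert u (insert v (e - {u, v}))" using e(4,5) by blast
    ultimately show "e \<in> (\<lambda>S. insert u (insert v S)) ` nsets ?V (k - 2)" by (rule rev_image_eqI)
  qed
  then have "card {e\<in>nsets {1..n} k. u \<in> e \<and> v \<in> e} \<le> card (nsets ?V (k - 2))"
    by (rule surj_card_le[rotated]) simp
  also have "\<dots> = (n - 2) choose (k - 2)"
    using assms by (simp add: card_nsets card_Diff_subset numeral_2_eq_2)
  finally show ?thesis .
qed

lemma card_crossing_edges:
  assumes "u \<in> R" "R \<subseteq> {1..n}" "k \<ge> 2"
  shows "card (crossing_edges n k R u) \<le> card R * ((n - 2) choose (k - 2))"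
proof -
  have fin: "finite R" using assms(2) by (rule finite_subset) simp
  have "crossing_edges n k R u \<subseteq> (\<Union>v\<in>R - {u}. {e\<in>nsets {1..n} k. u \<in> e \<and> v \<in> e})"
    using assms(1) by (auto simp: crossing_edges_def)
  then have "card (crossing_edges n k R u) \<le> card (\<Union>v\<in>R - {u}. {e\<in>nsets {1..n} k. u \<in> e \<and> v \<in> e})"
    using fin by (intro card_mono) auto
  also have "\<dots> \<le> (\<Sum>v\<in>R - {u}. card {e\<in>nsets {1..n} k. u \<in> e \<and> v \<in> e})"
    using fin by (intro card_UN_le) simp
  also have "\<dots> \<le> (\<Sum>v\<in>R - {u}. (n - 2) choose (k - 2))"
    using assms by (intro sum_mono card_pair_edges) auto
  also have "\<dots> \<le> card R * ((n - 2) choose (k - 2))"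
    using fin by (simp add: card_Diff_subset_Int mult_le_mono1 card_mono card_Diff1_le)
  finally show ?thesis .
qed

lemma tied_restrict:
  assumes "private_edges n k R \<sigma> u \<union> private_edges n k R (flip \<sigma> u) u \<subseteq> A"
  shows "tied n k R \<sigma> u H \<longleftrightarrow> tied n k R \<sigma> u (H \<inter> A)"
proof -
  have "H \<inter> A \<inter> private_edges n k R \<sigma> u = H \<inter> private_edges n k R \<sigma> u"
    "H \<inter> A \<inter> private_edges n k R (flip \<sigma> u) u = H \<inter> private_edges n k R (flip \<sigma> u) u"
    using assms by blast+
  then show ?thesis by (simp only: tied_def)
qed

text \<open>The private edges of distinct selected vertices are disjoint from each other, and those
  of \<open>u\<close> from its crossing edges. So ties are independent of each other, and each is
  independent of its own isolation, which fails with probability at most \<eta> by a union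
  bound.\<close>

lemma prob_isolated_tied:
  fixes m k s :: nat and p q r :: real
  assumes \<sigma>: "\<sigma> \<in> balanced_sign_vectors (2 * m)"
    and U: "U \<subseteq> positives (2 * m) \<sigma>" "card U = s" and W: "W \<subseteq> negatives (2 * m) \<sigma>" "card W = s"
    and "k \<ge> 2" and pq: "p \<in> {0..r}" "q \<in> {0..r}" "r \<le> 1"
  defines "N \<equiv> (m - s) choose (k - 1)"
  defines "b \<equiv> \<Sum>j\<le>N. pmf (binomial_pmf N p) j * pmf (binomial_pmf N q) j"
  defines "\<eta> \<equiv> 2 * s * ((2 * m - 2) choose (k - 2)) * r"
  defines "P \<equiv> random_hypergraph (2 * m) p q k \<sigma>"
  defines "G \<equiv> isolated_tied (2 * m) k (U \<union> W) \<sigma>"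
  shows "u \<in> U \<union> W \<Longrightarrow> b * (1 - \<eta>) \<le> measure_pmf.prob P {H. G u H}"
    and "u \<in> U \<union> W \<Longrightarrow> measure_pmf.prob P {H. G u H} \<le> b"
    and "u \<in> U \<union> W \<Longrightarrow> v \<in> U \<union> W \<Longrightarrow> u \<noteq> v \<Longrightarrow> measure_pmf.prob P {H. G u H \<and> G v H} \<le> b\<^sup>2"
proof -
  let ?E = "nsets {1..2*m} k" and ?r = "\<lambda>e. if same_community \<sigma> e then p else q"
  define R where "R = U \<union> W"
  define I where "I u = private_edges (2*m) k R \<sigma> u" for u
  define J where "J u = private_edges (2*m) k R (flip \<sigma> u) u" for u
  define X where "X u = crossing_edges (2*m) k R u" for u
  define T where "T = tied (2*m) k R \<sigma>"
  have P: "P = random_subset ?E ?r" unfolding P_def by (rule random_hypergraph_eq)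
  have fin: "finite ?E" by simp
  have sub: "I u \<subseteq> ?E" "J u \<subseteq> ?E" "X u \<subseteq> ?E" for u
    by (auto simp: I_def J_def X_def private_edges_def crossing_edges_def)
  have RV: "R \<subseteq> {1..2*m}" using U(1) W(1) by (auto simp: R_def positives_def negatives_def)
  have finR: "finite U" "finite W" using U W by (auto intro: finite_subset)
  have sz: "\<sigma> u \<noteq> 0" if "u \<in> R" for u
    using that U(1) W(1) by (auto simp: R_def positives_def negatives_def)
  have cR: "card R \<le> 2 * s" using U(2) W(2) card_Un_le[of U W] by (simp add: R_def)
  have tied: "measure_pmf.prob P {H. T u H} = b" if u: "u \<in> R" for u
    unfolding T_def tied_def P b_def I_def[symmetric] J_def[symmetric]
  proof (rule prob_random_subset_card_eq)
    show "I u \<inter> J u = {}" unfolding I_def J_def using sz[OF u] assms(6) by (rule private_edges_disjoint)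
    show "card (I u) = N" "card (J u) = N"
      using card_private_edges[OF \<sigma> U W, of u k] u \<open>k \<ge> 2\<close> by (simp_all add: I_def J_def N_def R_def)
    \<comment> \<open>An edge that is uniform after the flip is not uniform before it, by the
      disjointness just shown.\<close>
    then show "(if same_community \<sigma> e then p else q) = q" if "e \<in> J u" for e
      using that \<open>I u \<inter> J u = {}\<close> by (auto simp: I_def J_def private_edges_def)
  qed (use pq sub fin in \<open>auto simp: I_def private_edges_def\<close>)
  have tied_pair: "measure_pmf.prob P {H. T u H \<and> T v H} = b * b" if uv: "u \<in> R" "v \<in> R" "u \<noteq> v" for u v
  proof -
    have "measure_pmf.prob P {H. T u H \<and> T v H} = measure_pmf.prob P {H. T u H} * measure_pmf.prob P {H. T v H}"
      unfolding P
    proof (rule prob_random_subset_indep[of _ "I u \<union> J u" "I v \<union> J v"])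
      show "(I u \<union> J u) \<inter> (I v \<union> J v) = {}" using uv(3) by (auto simp: I_def J_def private_edges_def)
    qed (use sub fin in \<open>auto simp only: T_def I_def J_def intro!: tied_restrict\<close>)
    then show ?thesis using tied uv by simp
  qed
  have cross: "measure_pmf.prob P {H. H \<inter> X u \<noteq> {}} \<le> \<eta>" if u: "u \<in> R" for u
  proof -
    have "measure_pmf.prob P {H. H \<inter> X u \<noteq> {}} \<le> real (card (X u)) * r"
      unfolding P using pq fin sub by (intro prob_random_subset_hits) auto
    also have "\<dots> \<le> real (2 * s * ((2 * m - 2) choose (k - 2))) * r"
    proof (intro mult_right_mono of_nat_mono)
      have "card (X u) \<le> card R * ((2 * m - 2) choose (k - 2))"
        unfolding X_def using u RV \<open>k \<ge> 2\<close> by (rule card_crossing_edges)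
      also have "\<dots> \<le> 2 * s * ((2 * m - 2) choose (k - 2))" using cR by (rule mult_le_mono1)
      finally show "card (X u) \<le> 2 * s * ((2 * m - 2) choose (k - 2))" .
    qed (use pq in auto)
    finally show ?thesis by (simp add: \<eta>_def)
  qed
  have G: "G u H \<longleftrightarrow> T u H \<and> H \<inter> X u = {}" for u H
    by (simp add: G_def T_def X_def R_def isolated_tied_def)
  have b0: "b \<ge> 0" unfolding b_def by (intro sum_nonneg) auto
  have Gu: "measure_pmf.prob P {H. G u H} = b * (1 - measure_pmf.prob P {H. H \<inter> X u \<noteq> {}})" if u: "u \<in> R" for u
  proof -
    have "measure_pmf.prob P {H. G u H} = measure_pmf.prob P {H. T u H} * measure_pmf.prob P {H. H \<inter> X u = {}}"
      unfolding P G
    proof (rule prob_random_subset_indep[of _ "I u \<union> J u" "X u"])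
      show "(I u \<union> J u) \<inter> X u = {}" by (auto simp: I_def J_def X_def private_edges_def crossing_edges_def)
      show "T u H \<longleftrightarrow> T u (H \<inter> (I u \<union> J u))" for H
        unfolding T_def I_def J_def by (rule tied_restrict) simp
    qed (use sub fin in auto)
    moreover have "measure_pmf.prob P {H. H \<inter> X u = {}} = 1 - measure_pmf.prob P {H. H \<inter> X u \<noteq> {}}"
      using measure_pmf.prob_compl[of "{H. H \<inter> X u \<noteq> {}}" P] by (simp add: Compl_eq[symmetric] Collect_neg_eq[symmetric] flip: Compl_eq_Diff_UNIV)
    ultimately show ?thesis using tied[OF u] by simp
  qed
  show "b * (1 - \<eta>) \<le> measure_pmf.prob P {H. G u H}" if "u \<in> U \<union> W"
    using Gu[of u] cross[of u] that b0 by (simp add: R_def mult_left_mono)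
  show "measure_pmf.prob P {H. G u H} \<le> b" if "u \<in> U \<union> W"
    using Gu[of u] that b0 by (simp add: R_def mult_left_le)
  show "measure_pmf.prob P {H. G u H \<and> G v H} \<le> b\<^sup>2" if "u \<in> U \<union> W" "v \<in> U \<union> W" "u \<noteq> v"
  proof -
    \<comment> \<open>An edge through both \<open>u\<close> and \<open>v\<close> is crossing for
      both, so the two isolation conditions are not independent; dropping them still gives the upper
      bound.\<close>
    have "measure_pmf.prob P {H. G u H \<and> G v H} \<le> measure_pmf.prob P {H. T u H \<and> T v H}"
      by (intro measure_pmf.finite_measure_mono) (auto simp: G)
    then show ?thesis using tied_pair[of u v] that by (simp add: R_def power2_eq_square)
  qed
qed

lemma error_prob_ge_ties:
  fixes m k s M N :: nat and p q r a b \<eta> :: real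
  assumes "k \<ge> 2" "s \<le> m" and pq: "p \<in> {0..r}" "q \<in> {0..r}" "r \<le> 1"
  defines "N \<equiv> (m - s) choose (k - 1)"
  defines "b \<equiv> \<Sum>j\<le>N. pmf (binomial_pmf N p) j * pmf (binomial_pmf N q) j"
  defines "\<eta> \<equiv> 2 * s * ((2 * m - 2) choose (k - 2)) * r"
  defines "a \<equiv> s * b"
  assumes M: "M > 0" "real M \<le> a / 2"
  shows "error_prob (2 * m) p q k est \<ge> 1 - 2 * (4 / a + 8 * \<eta>) - 2 / M"
proof (rule error_prob_ge[OF M(1)])
  fix \<sigma> assume \<sigma>: "\<sigma> \<in> balanced_sign_vectors (2 * m)"
  let ?B = "balanced_sign_vectors (2 * m)"
  let ?P = "random_hypergraph (2 * m) p q k \<sigma>" and ?L = "\<lambda>\<tau> H. pmf (random_hypergraph (2 * m) p q k \<tau>) H"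
  \<comment> \<open>Any sets of size \<open>s\<close> will do: they may depend on \<sigma> but not
    on the hypergraph.\<close>
  obtain U where U: "U \<subseteq> positives (2 * m) \<sigma>" "card U = s"
    using obtain_subset_with_card_n[of s "positives (2*m) \<sigma>"] \<sigma> \<open>s \<le> m\<close> by (auto simp: balanced_iff)
  obtain W where W: "W \<subseteq> negatives (2 * m) \<sigma>" "card W = s"
    using obtain_subset_with_card_n[of s "negatives (2*m) \<sigma>"] \<sigma> \<open>s \<le> m\<close> by (auto simp: balanced_iff)
  have fin: "finite U" "finite W" using U W by (auto intro: finite_subset)
  define G where "G = isolated_tied (2 * m) k (U \<union> W) \<sigma>"
  note G_prob = prob_isolated_tied[OF \<sigma> U W \<open>k \<ge> 2\<close> pq, folded N_def, folded b_def \<eta>_def, folded G_def]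
  have "a > 0" using M by simp
  then have "b > 0" by (simp add: a_def zero_less_mult_iff)
  have few: "measure_pmf.prob ?P {H. card {u\<in>Z. G u H} < M} \<le> 4 / a + 8 * \<eta>" if "Z \<in> {U, W}" for Z
  proof -
    have Z: "finite Z" "real (card Z) * b = a" "Z \<subseteq> U \<union> W" using that fin U W by (auto simp: a_def)
    have "measure_pmf.prob ?P {H. card {u\<in>Z. G u H} < M} \<le> 4 / (real (card Z) * b) + 8 * \<eta>"
    proof (rule prob_few_events_le)
      fix u v assume "u \<in> Z" "v \<in> Z" "u \<noteq> v"
      then show "measure_pmf.prob ?P {H. G u H \<and> G v H} \<le> b\<^sup>2"
        using Z(3) by (intro G_prob(3)) auto
    qed (use Z G_prob(1,2) \<open>a > 0\<close> \<open>b > 0\<close> M(2) in auto)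
    then show ?thesis using Z by simp
  qed
  have "measure_pmf.prob ?P {H. card {\<tau>\<in>?B. ?L \<sigma> H \<le> ?L \<tau> H} < M}
      \<le> measure_pmf.prob ?P ({H. card {u\<in>U. G u H} < M} \<union> {H. card {u\<in>W. G u H} < M})"
  proof (intro measure_pmf.finite_measure_mono_AE)
    have "card {\<tau>\<in>?B. ?L \<sigma> H \<le> ?L \<tau> H} \<ge> M"
      if H: "H \<subseteq> nsets {1..2*m} k" and many: "card {u\<in>U. G u H} \<ge> M" "card {u\<in>W. G u H} \<ge> M" for H
    proof -
      have "{u\<in>W. G u H} \<noteq> {}" using many(2) \<open>M > 0\<close> by (intro notI) simp
      \<comment> \<open>One tied partner \<open>w\<close> is kept fixed while \<open>u\<close> runs
        through the tied vertices of \<open>U\<close>; this already produces \<open>M\<close>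
        distinct competitors.\<close>
      then obtain w where w: "w \<in> W" "G w H" by blast
      let ?f = "\<lambda>u. flip (flip \<sigma> u) w"
      have "inj_on ?f {u\<in>U. G u H}"
      proof (intro inj_onI)
        fix u v assume *: "u \<in> {u\<in>U. G u H}" "v \<in> {u\<in>U. G u H}" "?f u = ?f v"
        have "\<sigma> u = 1" using *(1) U(1) by (auto simp: positives_def)
        moreover have "\<sigma> w = -1" using W(1) w(1) by (auto simp: negatives_def)
        moreover have "?f u u = ?f v u" using *(3) by simp
        ultimately show "u = v" by (auto simp: flip_def split: if_splits)
      qed
      moreover have "?f ` {u\<in>U. G u H} \<subseteq> {\<tau>\<in>?B. ?L \<sigma> H \<le> ?L \<tau> H}"
      proof
        fix \<tau> assume "\<tau> \<in> ?f ` {u\<in>U. G u H}"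
        then obtain u where u: "u \<in> U" "G u H" "\<tau> = ?f u" by blast
        have "?L \<tau> H = ?L \<sigma> H"
          unfolding u(3) using u w U W H \<sigma> pq \<open>k \<ge> 2\<close>
          by (intro swap_likelihood[of _ _ _ _ _ _ _ "U \<union> W"]) (auto simp: G_def)
        moreover have "\<tau> \<in> ?B" unfolding u(3) using \<sigma> u w U W by (intro swap_balanced) auto
        ultimately show "\<tau> \<in> {\<tau>\<in>?B. ?L \<sigma> H \<le> ?L \<tau> H}" by simp
      qed
      ultimately have "card {u\<in>U. G u H} \<le> card {\<tau>\<in>?B. ?L \<sigma> H \<le> ?L \<tau> H}"
        by (intro card_inj_on_le) auto
      then show ?thesis using many(1) by linarith
    qed
    moreover have "set_pmf ?P \<subseteq> Pow (nsets {1..2*m} k)"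
      unfolding random_hypergraph_eq by (rule set_pmf_random_subset)
    ultimately have "card {u\<in>U. G u H} < M \<or> card {u\<in>W. G u H} < M"
      if "H \<in> set_pmf ?P" "card {\<tau>\<in>?B. ?L \<sigma> H \<le> ?L \<tau> H} < M" for H
      using that by (meson PowD leD not_le_imp_less subsetD)
    then show "AE H in measure_pmf ?P. H \<in> {H. card {\<tau>\<in>?B. ?L \<sigma> H \<le> ?L \<tau> H} < M} \<longrightarrow>
        H \<in> {H. card {u\<in>U. G u H} < M} \<union> {H. card {u\<in>W. G u H} < M}"
      unfolding AE_measure_pmf_iff by blast
  qed auto
  also have "\<dots> \<le> measure_pmf.prob ?P {H. card {u\<in>U. G u H} < M} + measure_pmf.prob ?P {H. card {u\<in>W. G u H} < M}"
    by (intro measure_Un_le) auto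
  also have "\<dots> \<le> 2 * (4 / a + 8 * \<eta>)" using few[of U] few[of W] by simp
  finally show "measure_pmf.prob ?P {H. card {\<tau>\<in>?B. ?L \<sigma> H \<le> ?L \<tau> H} < M} \<le> 2 * (4 / a + 8 * \<eta>)" .
qed

subsection \<open>The impossible regime\<close>

text \<open>The factor \<open>1 + 4 * r\<close> comes from
  \<open>(sqrt p + sqrt q)^2 \<le> 4 * r\<close> in \<open>bhattacharyya_ge\<close>, the factor
  \<open>1 + 2 * r\<close> from passing from \<open>1 - w\<close> to an exponential with
  \<open>w \<le> r\<close>. Both tend to 1 with \<open>r\<close>.\<close>

lemma binomial_collision_ge_exp:
  fixes p q r :: real and N :: nat
  assumes p: "p \<in> {0..r}" and q: "q \<in> {0..r}" and r: "r \<le> 1/4"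
  shows "exp (- (N * (sqrt p - sqrt q)\<^sup>2 * ((1 + 4 * r) * (1 + 2 * r)))) / (4 * (4 * N * r + 3)) \<le>
    (\<Sum>j\<le>N. pmf (binomial_pmf N p) j * pmf (binomial_pmf N q) j)"
proof -
  define \<kappa> where "\<kappa> = (sqrt p - sqrt q)\<^sup>2"
  define w where "w = \<kappa> / 2 * (1 + (sqrt p + sqrt q)\<^sup>2)"
  define z where "z = sqrt (p * q) + sqrt ((1 - p) * (1 - q))"
  have r0: "r \<ge> 0" using p by simp
  have pq: "p \<in> {0..1/2}" "q \<in> {0..1/2}" using p q r by auto
  have "\<kappa> \<ge> 0" by (simp add: \<kappa>_def)
  have pq_r: "sqrt (p * q) \<le> r"
  proof -
    have "p * q \<le> r * r" using p q by (intro mult_mono) auto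
    then have "sqrt (p * q) \<le> sqrt (r * r)" by (rule real_sqrt_le_mono)
    then show ?thesis using r0 by simp
  qed
  have "(sqrt p + sqrt q)\<^sup>2 = p + q + 2 * sqrt (p * q)"
    using p q by (simp add: power2_sum real_sqrt_mult)
  then have sum_le: "(sqrt p + sqrt q)\<^sup>2 \<le> 4 * r" using p q pq_r by simp
  have "\<kappa> \<le> r"
  proof -
    have "\<bar>sqrt p - sqrt q\<bar> \<le> sqrt r"
    proof -
      have "0 \<le> sqrt p" "sqrt p \<le> sqrt r" "0 \<le> sqrt q" "sqrt q \<le> sqrt r" using p q by auto
      then show ?thesis by linarith
    qed
    then have "\<bar>sqrt p - sqrt q\<bar>\<^sup>2 \<le> (sqrt r)\<^sup>2" by (intro power_mono) auto
    then show ?thesis using r0 by (simp add: \<kappa>_def)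
  qed
  have w_le: "w \<le> \<kappa> / 2 * (1 + 4 * r)"
    unfolding w_def using sum_le \<open>\<kappa> \<ge> 0\<close> by (intro mult_left_mono) auto
  also have "\<dots> \<le> r / 2 * 2" using \<open>\<kappa> \<le> r\<close> \<open>\<kappa> \<ge> 0\<close> r r0 by (intro mult_mono) auto
  finally have "w \<le> r" by simp
  have "w \<ge> 0" using \<open>\<kappa> \<ge> 0\<close> by (simp add: w_def)
  have "exp (- (N * \<kappa> * ((1 + 4 * r) * (1 + 2 * r)))) \<le> exp (real (2 * N) * (- (w + 2 * w\<^sup>2)))"
  proof -
    have "w + 2 * w\<^sup>2 = w * (1 + 2 * w)" by (simp add: power2_eq_square algebra_simps)
    also have "\<dots> \<le> \<kappa> / 2 * (1 + 4 * r) * (1 + 2 * r)"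
      using w_le \<open>w \<ge> 0\<close> \<open>w \<le> r\<close> \<open>\<kappa> \<ge> 0\<close> r0 by (intro mult_mono) auto
    finally have "real (2 * N) * (w + 2 * w\<^sup>2) \<le> real (2 * N) * (\<kappa> / 2 * (1 + 4 * r) * (1 + 2 * r))"
      by (intro mult_left_mono) auto
    then show ?thesis by (simp add: algebra_simps)
  qed
  also have "\<dots> = exp (- (w + 2 * w\<^sup>2)) ^ (2 * N)" by (rule exp_of_nat_mult)
  also have "\<dots> \<le> (1 - w) ^ (2 * N)"
    using \<open>w \<ge> 0\<close> \<open>w \<le> r\<close> r by (intro power_mono exp_le_one_minus) auto
  also have "\<dots> \<le> z ^ (2 * N)"
  proof (rule power_mono)
    show "1 - w \<le> z" using bhattacharyya_ge[OF pq] by (simp add: w_def \<kappa>_def z_def)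
    show "0 \<le> 1 - w" using \<open>w \<le> r\<close> r by simp
  qed
  finally have num: "exp (- (N * \<kappa> * ((1 + 4 * r) * (1 + 2 * r)))) \<le> z ^ (2 * N)" .
  have "exp (- (N * \<kappa> * ((1 + 4 * r) * (1 + 2 * r)))) / (4 * (4 * N * r + 3)) \<le>
      z ^ (2 * N) / (4 * (4 * N * sqrt (p * q) + 3))"
  proof (rule frac_le)
    have "4 * N * sqrt (p * q) \<le> 4 * N * r" using pq_r by (intro mult_left_mono) auto
    then show "4 * (4 * N * sqrt (p * q) + 3) \<le> 4 * (4 * N * r + 3)" by simp
    show "0 < 4 * (4 * N * sqrt (p * q) + 3)" using p q by (simp add: add_nonneg_pos)
  qed (use num in \<open>auto intro: order_trans[OF exp_ge_zero]\<close>)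
  also have "\<dots> \<le> (\<Sum>j\<le>N. pmf (binomial_pmf N p) j * pmf (binomial_pmf N q) j)"
    unfolding z_def by (rule binomial_collision_ge[OF pq])
  finally show ?thesis unfolding \<kappa>_def .
qed

text \<open>The absorption identity. It shows that edges through a second given vertex are a
  fraction of order 1 / n of the edges at a vertex, so about n^(1 - \<epsilon>) selected vertices
  rarely share one.\<close>

lemma crossing_ratio:
  assumes "k \<ge> 2" "n > k"
  shows "real ((n - 2) choose (k - 2)) / real ((n - 1) choose (k - 1)) = (real k - 1) / (real n - 1)"
proof -
  have "k - 1 = Suc (k - 2)" "n - 1 - 1 = n - 2" using assms by auto
  then have "(k - 1) * ((n - 1) choose (k - 1)) = (n - 1) * ((n - 2) choose (k - 2))"
    using binomial_absorption[of "k - 2" "n - 1"] by metis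
  then have "real (k - 1) * real ((n - 1) choose (k - 1)) = real (n - 1) * real ((n - 2) choose (k - 2))"
    by (metis of_nat_mult)
  moreover have "real (k - 1) = real k - 1" "real (n - 1) = real n - 1" using assms by (auto simp: of_nat_diff)
  moreover have "real ((n - 1) choose (k - 1)) > 0" using assms by auto
  ultimately show ?thesis using assms by (simp add: field_simps)
qed

text \<open>The estimate at a fixed \<open>n\<close>: \<open>A\<close> bounds the reference number
  of ties \<open>a\<close> from below and \<open>B\<close> bounds \<eta> from above, so that only
  the limits of \<open>A\<close> and \<open>B\<close> remain to be found.\<close>

lemma error_prob_ge_asymp:
  fixes m k :: nat and \<alpha> \<beta> \<mu> \<rho> \<gamma> \<epsilon> :: real
  defines "n \<equiv> 2 * m" and "j \<equiv> k - 1" and "\<kappa> \<equiv> (sqrt \<alpha> - sqrt \<beta>)\<^sup>2"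
  defines "x \<equiv> ln n / ((n - 1) choose j)"
  defines "A \<equiv> n powr (1 - \<epsilon> - \<gamma>) / (2 * (16 * \<mu> * ln n + 12))"
    and "B \<equiv> 4 * \<mu> * (real k - 1) * (ln n * n powr (- \<epsilon>))"
  assumes "k \<ge> 2" and ab: "0 < \<alpha>" "\<alpha> \<le> \<mu>" "0 < \<beta>" "\<beta> \<le> \<mu>" and \<rho>: "0 < \<rho>" "\<rho> \<le> 1/4"
    and \<gamma>: "\<kappa> * (1/2 + \<rho>) ^ j * ((1 + 4 * \<rho>) * (1 + 2 * \<rho>)) \<le> \<gamma>"
    and n: "n > k" "m / (real n - 1 - real j) \<le> 1/2 + \<rho>" "\<mu> * x \<le> \<rho>"
      "2 \<le> n powr (1 - \<epsilon>)" "2 \<le> n powr \<epsilon>" "4 \<le> A"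
  shows "error_prob n (\<alpha> * x) (\<beta> * x) k est \<ge> 1 - 16 / A - 16 * B"
proof -
  \<comment> \<open>The exponent stays below 1 to make crossing edges rare and will exceed \<gamma>
    to make ties numerous.\<close>
  define s where "s = nat \<lfloor>n powr (1 - \<epsilon>)\<rfloor>"
  define N where "N = (m - s) choose j"
  define C where "C = real ((n - 1) choose j)"
  define r where "r = \<mu> * x"
  define b where "b = (\<Sum>i\<le>N. pmf (binomial_pmf N (\<alpha> * x)) i * pmf (binomial_pmf N (\<beta> * x)) i)"
  define a where "a = s * b"
  define \<eta> where "\<eta> = 2 * s * ((n - 2) choose (k - 2)) * r"
  \<comment> \<open>The largest choice that the second moment bound permits;
    \<open>4 \<le> A\<close> ensures that rounding leaves at least \<open>a / 4\<close>.\<close>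
  define M where "M = nat \<lfloor>a / 2\<rfloor>"
  have j: "j \<ge> 1" "n - 1 > j" using \<open>k \<ge> 2\<close> n(1) by (auto simp: j_def)
  have "\<mu> > 0" using ab by linarith
  have n1: "real n > 1" "ln n > 0" using n(1) \<open>k \<ge> 2\<close> by auto
  have C0: "C > 0" using j by (auto simp: C_def)
  have x0: "x \<ge> 0" using n1 by (auto simp: x_def)
  have s_le: "real s \<le> n powr (1 - \<epsilon>)" by (simp add: s_def)
  have s_ge: "real s \<ge> n powr (1 - \<epsilon>) / 2"
  proof -
    have "real s = real_of_int \<lfloor>n powr (1 - \<epsilon>)\<rfloor>" by (simp add: s_def)
    then have "real s \<ge> n powr (1 - \<epsilon>) - 1" by linarith
    then show ?thesis using n(4) by linarith
  qed
  have "s \<le> m"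
  proof -
    have "2 * n powr (1 - \<epsilon>) \<le> n powr \<epsilon> * n powr (1 - \<epsilon>)" using n(5) by (intro mult_right_mono) auto
    also have "\<dots> = n" using n1 by (simp flip: powr_add)
    finally show ?thesis using s_le by (simp add: n_def)
  qed
  have NC: "real N / C \<le> (1/2 + \<rho>) ^ j"
  proof -
    have "real N / C \<le> (m / (real n - 1 - real j)) ^ j"
      unfolding N_def C_def using j by (intro binomial_ratio_le) auto
    also have "\<dots> \<le> (1/2 + \<rho>) ^ j"
      using n(1,2) \<open>k \<ge> 2\<close> by (intro power_mono divide_nonneg_nonneg) (auto simp: j_def of_nat_diff)
    finally show ?thesis .
  qed
  have NC1: "real N / C \<le> 1"
    using NC power_le_one[of "1/2 + \<rho>" j] \<rho> by linarith
  have r: "0 \<le> r" "r \<le> \<rho>" "r \<le> 1/4" using n(3) x0 \<open>\<mu> > 0\<close> \<rho> by (auto simp: r_def)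
  have pr: "\<alpha> * x \<in> {0..r}" "\<beta> * x \<in> {0..r}" using ab x0 by (auto simp: r_def intro: mult_right_mono)
  have Nx: "real N * x = real N / C * ln n" by (simp add: x_def C_def)
  have b_ge: "b \<ge> n powr (- \<gamma>) / (16 * \<mu> * ln n + 12)"
  proof -
    have "real N * (sqrt (\<alpha> * x) - sqrt (\<beta> * x))\<^sup>2 * ((1 + 4 * r) * (1 + 2 * r)) \<le> \<gamma> * ln n"
    proof -
      have "(sqrt (\<alpha> * x) - sqrt (\<beta> * x))\<^sup>2 = \<kappa> * x"
        unfolding \<kappa>_def using x0 ab by (intro sqrt_diff_scaled) auto
      then have "real N * (sqrt (\<alpha> * x) - sqrt (\<beta> * x))\<^sup>2 * ((1 + 4 * r) * (1 + 2 * r))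
          = \<kappa> * (real N / C) * ((1 + 4 * r) * (1 + 2 * r)) * ln n"
        using Nx by (simp add: mult_ac)
      also have "\<dots> \<le> \<kappa> * (1/2 + \<rho>) ^ j * ((1 + 4 * \<rho>) * (1 + 2 * \<rho>)) * ln n"
        using NC r \<rho> n1 C0 by (intro mult_right_mono mult_mono mult_left_mono mult_nonneg_nonneg) (auto simp: \<kappa>_def)
      also have "\<dots> \<le> \<gamma> * ln n" using \<gamma> n1 by (intro mult_right_mono) auto
      finally show ?thesis .
    qed
    then have num: "n powr (- \<gamma>) \<le> exp (- (real N * (sqrt (\<alpha> * x) - sqrt (\<beta> * x))\<^sup>2 * ((1 + 4 * r) * (1 + 2 * r))))"
      using n1 by (simp add: powr_def)
    have "real N * r = \<mu> * (real N / C) * ln n" using Nx by (simp add: r_def mult_ac)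
    also have "\<dots> \<le> \<mu> * 1 * ln n"
      using NC1 \<open>\<mu> > 0\<close> n1 by (intro mult_right_mono mult_left_mono) auto
    finally have den: "4 * (4 * N * r + 3) \<le> 16 * \<mu> * ln n + 12" by simp
    have "n powr (- \<gamma>) / (16 * \<mu> * ln n + 12) \<le>
      exp (- (real N * (sqrt (\<alpha> * x) - sqrt (\<beta> * x))\<^sup>2 * ((1 + 4 * r) * (1 + 2 * r)))) / (4 * (4 * N * r + 3))"
      using num den r by (intro frac_le) (auto intro!: add_nonneg_pos)
    also have "\<dots> \<le> b" unfolding b_def using pr r(3) by (rule binomial_collision_ge_exp)
    finally show ?thesis .
  qed
  have D0: "16 * \<mu> * ln n + 12 > 0" using \<open>\<mu> > 0\<close> n1 by (simp add: add_pos_pos)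
  have "A = n powr (1 - \<epsilon>) / 2 * (n powr (- \<gamma>) / (16 * \<mu> * ln n + 12))"
    by (simp add: A_def diff_conv_add_uminus[of _ \<gamma>] powr_add del: add_uminus_conv_diff)
  also have "\<dots> \<le> a"
    unfolding a_def using s_ge b_ge D0 by (intro mult_mono) auto
  finally have Aa: "A \<le> a" .
  have M: "real M \<le> a / 2" "real M \<ge> a / 4"
  proof -
    have M': "real M = real_of_int \<lfloor>a / 2\<rfloor>" using Aa n(6) by (simp add: M_def)
    show "real M \<le> a / 2" unfolding M' by linarith
    have "real M \<ge> a / 2 - 1" unfolding M' by linarith
    then show "real M \<ge> a / 4" using Aa n(6) by linarith
  qed
  have "M > 0" using M(2) Aa n(6) by linarith
  have \<eta>B: "\<eta> \<le> B"
  proof -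
    have "\<eta> = 2 * \<mu> * real s * ln n * (((n - 2) choose (k - 2)) / C)"
      by (simp add: \<eta>_def r_def x_def C_def mult_ac)
    also have "\<dots> = 2 * \<mu> * real s * ln n * ((real k - 1) / (real n - 1))"
      unfolding C_def j_def using crossing_ratio[of k n] n(1) \<open>k \<ge> 2\<close> by simp
    also have "\<dots> \<le> 2 * \<mu> * n powr (1 - \<epsilon>) * ln n * ((real k - 1) / (real n / 2))"
      using s_le \<open>\<mu> > 0\<close> n1 n(1) \<open>k \<ge> 2\<close>
      by (intro mult_mono mult_right_mono mult_left_mono divide_left_mono mult_nonneg_nonneg) auto
    also have "n powr (1 - \<epsilon>) = n * n powr (- \<epsilon>)"
      using n1 by (simp add: diff_conv_add_uminus powr_add del: add_uminus_conv_diff)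
    also have "2 * \<mu> * (n * n powr (- \<epsilon>)) * ln n * ((real k - 1) / (real n / 2)) = B"
      using n1 by (simp add: B_def field_simps)
    finally show ?thesis .
  qed
  \<comment> \<open>The second moment bound contributes \<open>8 / a\<close>, and
    \<open>M \<ge> a / 4\<close> turns \<open>2 / M\<close> into another
    \<open>8 / a\<close>.\<close>
  have "1 - 16 / A - 16 * B \<le> 1 - 2 * (4 / a + 8 * \<eta>) - 2 / M"
  proof -
    have "2 / M \<le> 2 / (a / 4)" using M(2) Aa n(6) by (intro divide_left_mono) auto
    moreover have "16 / a \<le> 16 / A" using Aa n(6) by (intro divide_left_mono) auto
    ultimately show ?thesis using \<eta>B by simp
  qed
  also have "\<dots> \<le> error_prob n (\<alpha> * x) (\<beta> * x) k est"
    unfolding n_def a_def b_def N_def \<eta>_def j_def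
  proof (rule error_prob_ge_ties)
  qed (use \<open>k \<ge> 2\<close> \<open>s \<le> m\<close> pr r M \<open>M > 0\<close> in \<open>simp_all add: a_def b_def N_def j_def n_def\<close>)
  finally show ?thesis .
qed

lemma exact_recovery_impossible_below_threshold:
  fixes k :: nat and \<alpha> \<beta> :: real and p q :: "nat \<Rightarrow> real"
  assumes "k \<ge> 2" "\<alpha> > 0" "\<beta> > 0"
    and p: "\<And>n. even n \<Longrightarrow> n > 0 \<Longrightarrow> p n = \<alpha> * ln (real n) / real ((n - 1) choose (k - 1))"
    and q: "\<And>n. even n \<Longrightarrow> n > 0 \<Longrightarrow> q n = \<beta> * ln (real n) / real ((n - 1) choose (k - 1))"
    and I: "recovery_threshold k \<alpha> \<beta> < 1"
  shows "exact_recovery_impossible k p q"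
  unfolding exact_recovery_impossible_def
proof (intro allI impI)
  fix est :: "nat \<Rightarrow> nat set set \<Rightarrow> nat \<Rightarrow> int"
  define \<kappa> where "\<kappa> = (sqrt \<alpha> - sqrt \<beta>)\<^sup>2"
  define j where "j = k - 1"
  \<comment> \<open>A common bound for both constants, so that neither order of \<alpha> and \<beta>
    is singled out.\<close>
  define \<mu> where "\<mu> = max \<alpha> \<beta>"
  have \<mu>: "\<mu> > 0" using assms by (simp add: \<mu>_def)
  let ?g = "\<lambda>\<rho>. \<kappa> * (1/2 + \<rho>) ^ j * ((1 + 4 * \<rho>) * (1 + 2 * \<rho>))"
  \<comment> \<open>At \<rho> = 0 this is the recovery threshold itself, which is below 1; a small
    positive \<rho> leaves room for all lower order losses.\<close>
  have "(?g \<longlongrightarrow> \<kappa> * (1/2 + 0) ^ j * ((1 + 4 * 0) * (1 + 2 * 0))) (at_right 0)"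
    by (intro tendsto_intros)
  moreover have "\<kappa> * (1/2 + 0) ^ j * ((1 + 4 * 0) * (1 + 2 * 0)) < 1"
    using I by (simp add: recovery_threshold_def \<kappa>_def j_def power_one_over field_simps)
  ultimately have "eventually (\<lambda>\<rho>. ?g \<rho> < 1) (at_right 0)"
    by (rule order_tendstoD)
  moreover have "eventually (\<lambda>\<rho>::real. \<rho> \<in> {0<..<1/4}) (at_right 0)"
    by (intro eventually_at_right_real) auto
  ultimately have "eventually (\<lambda>\<rho>. ?g \<rho> < 1 \<and> \<rho> \<in> {0<..<1/4}) (at_right 0)"
    by (rule eventually_conj)
  from eventually_happens'[OF trivial_limit_at_right_real this]
  obtain \<rho> where \<rho>: "?g \<rho> < 1" "0 < \<rho>" "\<rho> < 1/4" by auto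
  define \<gamma> where "\<gamma> = ?g \<rho>"
  \<comment> \<open>Splits the gap \<open>1 - \<gamma>\<close> evenly: one half makes
    \<open>B\<close> vanish, the other is the exponent with which \<open>A\<close> grows, up to the
    logarithm.\<close>
  define \<epsilon> where "\<epsilon> = (1 - \<gamma>) / 2"
  have "\<gamma> \<ge> 0" unfolding \<gamma>_def \<kappa>_def using \<rho> by (intro mult_nonneg_nonneg) auto
  have "\<gamma> < 1" using \<rho> by (simp add: \<gamma>_def)
  have \<epsilon>: "\<epsilon> > 0" "1 - \<epsilon> > 0" "1 - \<epsilon> - \<gamma> > 0"
    using \<open>\<gamma> \<ge> 0\<close> \<open>\<gamma> < 1\<close> by (auto simp: \<epsilon>_def field_simps)
  define A where "A = (\<lambda>n::nat. n powr (1 - \<epsilon> - \<gamma>) / (2 * (16 * \<mu> * ln n + 12)))"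
  define B where "B = (\<lambda>n::nat. 4 * \<mu> * (real k - 1) * (ln n * n powr (- \<epsilon>)))"
  have powr_top: "filterlim (\<lambda>n::nat. n powr d) at_top sequentially" if "d > 0" for d
    using that by real_asymp
  have A: "filterlim A at_top sequentially"
    unfolding A_def using \<mu> \<epsilon>(3) by real_asymp
  have "((\<lambda>n::nat. ln n * n powr (- \<epsilon>)) \<longlongrightarrow> 0) sequentially"
    using \<epsilon>(1) by real_asymp
  from tendsto_mult[OF tendsto_const[of "4 * \<mu> * (real k - 1)"] this]
  have B: "(B \<longlongrightarrow> 0) sequentially" by (simp add: B_def)
  let ?err = "\<lambda>n. error_prob n (p n) (q n) k (est n)"
  have "eventually (\<lambda>n. even n \<longrightarrow> ?err n \<ge> 1 - 16 / A n - 16 * B n) sequentially"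
  proof -
    have "((\<lambda>n::nat. (n / 2) / (real n - 1 - real j)) \<longlongrightarrow> 1/2) sequentially" by real_asymp
    then have "eventually (\<lambda>n::nat. (n / 2) / (real n - 1 - real j) < 1/2 + \<rho>) sequentially"
      by (rule order_tendstoD) (use \<rho> in simp)
    moreover have "eventually (\<lambda>n. \<mu> * ln (real n) / real ((n - 1) choose (k - 1)) \<in> {0..\<rho>}) sequentially"
      using \<open>k \<ge> 2\<close> \<mu> \<rho>(2) by (rule edge_prob_small)
    moreover have "eventually (\<lambda>n::nat. 2 \<le> n powr (1 - \<epsilon>)) sequentially"
      "eventually (\<lambda>n::nat. 2 \<le> n powr \<epsilon>) sequentially" "eventually (\<lambda>n. 4 \<le> A n) sequentially"
      using powr_top[OF \<epsilon>(2)] powr_top[OF \<epsilon>(1)] A by (simp_all add: filterlim_at_top)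
    ultimately show ?thesis using eventually_gt_at_top[of k]
    proof eventually_elim
      case (elim n)
      show ?case
      proof
        assume "even n"
        then obtain m where n: "n = 2 * m" by (elim evenE)
        have "n > 0" using elim by simp
        let ?x = "ln (real n) / real ((n - 1) choose (k - 1))"
        have pq: "p n = \<alpha> * ?x" "q n = \<beta> * ?x"
          using p[OF \<open>even n\<close> \<open>n > 0\<close>] q[OF \<open>even n\<close> \<open>n > 0\<close>] by simp_all
        show "1 - 16 / A n - 16 * B n \<le> ?err n"
          unfolding pq unfolding n A_def B_def
        proof (rule error_prob_ge_asymp)
          show "real m / (real (2 * m) - 1 - real (k - 1)) \<le> 1/2 + \<rho>"
            using elim(1) unfolding n j_def by simp
          show "\<mu> * (ln (real (2 * m)) / real ((2 * m - 1) choose (k - 1))) \<le> \<rho>"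
            using elim(2) unfolding n by simp
          show "2 \<le> real (2 * m) powr (1 - \<epsilon>)" "2 \<le> real (2 * m) powr \<epsilon>"
            using elim(3,4) by (simp_all only: n)
          show "4 \<le> real (2 * m) powr (1 - \<epsilon> - \<gamma>) / (2 * (16 * \<mu> * ln (real (2 * m)) + 12))"
            using elim(5) by (simp only: A_def n)
          show "(sqrt \<alpha> - sqrt \<beta>)\<^sup>2 * (1/2 + \<rho>) ^ (k - 1) * ((1 + 4 * \<rho>) * (1 + 2 * \<rho>)) \<le> \<gamma>"
            by (simp add: \<gamma>_def \<kappa>_def j_def)
          show "k < 2 * m" using elim n by simp
        qed (use \<rho> assms(1-3) in \<open>simp_all add: \<mu>_def\<close>)
      qed
    qed
  qed
  then have "eventually (\<lambda>n. 1 - 16 / A n - 16 * B n \<le> ?err n) even_sequentially"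
    unfolding even_sequentially_def by (simp add: eventually_inf_principal)
  moreover have "((\<lambda>n. 1 - 16 / A n - 16 * B n) \<longlongrightarrow> 1) even_sequentially"
  proof -
    have "((\<lambda>n. 16 / A n) \<longlongrightarrow> 0) sequentially"
      using A by (intro real_tendsto_divide_at_top[OF tendsto_const])
    from tendsto_diff[OF tendsto_diff[OF tendsto_const[of 1] this] tendsto_mult[OF tendsto_const[of 16] B]]
    show ?thesis by (intro tendsto_even_sequentiallyI) simp
  qed
  moreover have "eventually (\<lambda>n. ?err n \<le> 1) even_sequentially" by (simp add: error_prob_def)
  ultimately show "(?err \<longlongrightarrow> 1) even_sequentially"
    using tendsto_sandwich[of "\<lambda>n. 1 - 16 / A n - 16 * B n" ?err even_sequentially "\<lambda>_. 1" 1] by simp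
qed

theorem theorem1:
  fixes k :: nat and \<alpha> \<beta> :: real and p q :: "nat \<Rightarrow> real"
  assumes "k \<ge> 2" and "\<alpha> > 0" and "\<beta> > 0"
    and "\<And>n. even n \<Longrightarrow> n > 0 \<Longrightarrow> p n = \<alpha> * ln (real n) / real ((n - 1) choose (k - 1))"
    and "\<And>n. even n \<Longrightarrow> n > 0 \<Longrightarrow> q n = \<beta> * ln (real n) / real ((n - 1) choose (k - 1))"
  shows "(recovery_threshold k \<alpha> \<beta> > 1 \<longrightarrow> exact_recovery_possible k p q) \<and>
         (recovery_threshold k \<alpha> \<beta> < 1 \<longrightarrow> exact_recovery_impossible k p q)"
  using exact_recovery_possible_above_threshold[OF assms]
    exact_recovery_impossible_below_threshold[OF assms] by blast

end
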